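(* Let $g\ge 3$, $k\ge 0$, let $m,n\ge1$ be odd integers, and let $\alpha,\beta$ be non-negative integers with $\alpha\ne 1$, $\beta\ne 1$ and $\alpha+\beta=3\cdot 2^kmn$. Then an $RSM_\Gamma(\Gamma\setminus 2\Gamma,g;[\,^{\alpha}m,\ ^{\beta}2^kn])$ exists.
   Context: Let $G=\mathbb{Z}_m\times\mathbb{Z}_{2^{k+1}n}$ and let $\Gamma$ be the generalized dihedral group on $G$: underlying set $G\times\mathbb{Z}_2$ with operation $(x,\tau)+(x',\tau')=(x+(-1)^\tau x',\tau+\tau')$; elements written $(a,b,\tau)$. Let $2\Gamma=\{(a,b,0): a\in\mathbb{Z}_m,\ b\in\mathbb{Z}_{2^{k+1}n}\text{ even}\}$, a subset of order $2^kmn$. $[\,^{a}x,\,^{b}y]$ denotes the multiset with $a$ copies of $x$ and $b$ copies of $y$. For $S\subseteq\Gamma$ and a list $L$ of positive integers of length $|S|$, an $RSM_\Gamma(S,g;L)$ is an $|S|\times g$ matrix with entries in $\Gamma$ such that each column is a permutation (arrangement) of $S$ and the multiset of orders (in $\Gamma$) of the left-to-right row sums equals $L$. *)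

theory Defs
  imports Main "HOL-Library.Multiset"
begin

text \<open>Generalized dihedral group on G = Z_m x Z_N (N = 2^(k+1) n).
  Elements are triples (a, b, tau) with a in {0..<m}, b in {0..<N}, tau :: bool
  (False = 0, True = 1). Operation:
  (x,tau) + (x',tau') = (x + (-1)^tau x', tau + tau').\<close>

type_synonym delt = "int \<times> int \<times> bool"

definition dih_carrier :: "int \<Rightarrow> int \<Rightarrow> delt set" where
  "dih_carrier m N = {(a, b, t). 0 \<le> a \<and> a < m \<and> 0 \<le> b \<and> b < N}"

definition dih_add :: "int \<Rightarrow> int \<Rightarrow> delt \<Rightarrow> delt \<Rightarrow> delt" where
  "dih_add m N x y = (case x of (a, b, t) \<Rightarrow> case y of (a', b', t') \<Rightarrow>
     (if t then ((a - a') mod m, (b - b') mod N, t \<noteq> t')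
           else ((a + a') mod m, (b + b') mod N, t \<noteq> t')))"

definition dih_zero :: delt where
  "dih_zero = (0, 0, False)"

fun dih_mult :: "int \<Rightarrow> int \<Rightarrow> nat \<Rightarrow> delt \<Rightarrow> delt" where
  "dih_mult m N 0 x = dih_zero"
| "dih_mult m N (Suc j) x = dih_add m N x (dih_mult m N j x)"

definition dih_ord :: "int \<Rightarrow> int \<Rightarrow> delt \<Rightarrow> nat" where
  "dih_ord m N x = (LEAST j. 0 < j \<and> dih_mult m N j x = dih_zero)"

definition dih_two :: "int \<Rightarrow> int \<Rightarrow> delt set" where
  "dih_two m N = {(a, b, t) \<in> dih_carrier m N. \<not> t \<and> even b}"

definition row_sum :: "int \<Rightarrow> int \<Rightarrow> (nat \<Rightarrow> nat \<Rightarrow> delt) \<Rightarrow> nat \<Rightarrow> nat \<Rightarrow> delt" where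
  "row_sum m N M g i = foldl (dih_add m N) dih_zero (map (\<lambda>j. M i j) [0..<g])"

definition is_RSM :: "int \<Rightarrow> int \<Rightarrow> delt set \<Rightarrow> nat \<Rightarrow> nat multiset
                      \<Rightarrow> (nat \<Rightarrow> nat \<Rightarrow> delt) \<Rightarrow> bool" where
  "is_RSM m N S g L M \<longleftrightarrow>
     S \<subseteq> dih_carrier m N \<and> finite S \<and> size L = card S \<and>
     (\<forall>j<g. bij_betw (\<lambda>i. M i j) {..<card S} S) \<and>
     image_mset (\<lambda>i. dih_ord m N (row_sum m N M g i)) (mset [0..<card S]) = L"

end

theory Submission
  imports Defs "HOL-Combinatorics.Transposition"
begin

text \<open>Write the group on which \<open>\<Gamma>\<close> is built as \<open>\<int>\<^sub>m \<times> \<int>\<^sub>2\<^sub>K\<close> with \<open>K = 2\<^sup>k n\<close>. Modulo the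
  commutator subgroup \<open>2\<Gamma> \<cong> \<int>\<^sub>m \<times> \<int>\<^sub>K\<close> the set \<open>\<Gamma> - 2\<Gamma>\<close> splits into three cosets: the odd rotations,
  the even reflections and the odd reflections.

  Start from an explicit array with all row sums zero. If \<open>\<alpha>\<close> or \<open>\<beta>\<close> is odd, exchange a few entries
  so that exactly three rows, one for every coset of the last entry, get a row sum \<open>(a, c)\<close> where \<open>a\<close>
  generates \<open>\<int>\<^sub>m\<close> (if \<open>\<alpha>\<close> is odd, otherwise \<open>a = 0\<close>) and \<open>c\<close> generates \<open>\<int>\<^sub>K\<close> (if \<open>\<beta>\<close> is odd, otherwise
  \<open>c = 0\<close>). Permuting the last entries inside one coset changes the row sums by the differences of two
  enumerations of \<open>2\<Gamma>\<close>, and by a theorem of M. Hall every sequence with sum zero occurs as such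
  differences. So in every coset the row sums can be replaced by any list with the same sum, e.g. by
  \<open>a\<close>, \<open>c\<close> and pairs \<open>\<plusminus>(1, 0)\<close>, \<open>\<plusminus>(0, 1)\<close>. Two further columns \<open>x\<close>, \<open>- x\<close> do not change the row sums,
  hence arrays with three and with four columns suffice.\<close>

section \<open>Splittings and matchings\<close>

text \<open>Greedy filling works: since \<open>c\<close> is even, capping at \<open>c\<close> keeps
  every part even.\<close>

lemma split_even_three:
  fixes e c :: nat
  assumes "even e" "even c" "e \<le> 3 * c"
  shows "\<exists>e1 e2 e3. e1 + e2 + e3 = e \<and> e1 \<le> c \<and> e2 \<le> c \<and> e3 \<le> c \<and> even e1 \<and> even e2 \<and> even e3"
proof -
  define e1 where "e1 = min e c"
  define e2 where "e2 = min (e - e1) c"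
  have "even e1" "even e2" using assms by (auto simp: e1_def e2_def min_def)
  then have "even e1" "even e2" "even (e - e1 - e2)" using assms by auto
  moreover have "e1 + e2 + (e - e1 - e2) = e" "e1 \<le> c" "e2 \<le> c" "e - e1 - e2 \<le> c"
    using assms by (auto simp: e1_def e2_def)
  ultimately show ?thesis by blast
qed

text \<open>The parts become the numbers of rows of order \<open>m\<close> in the three cosets. An
  odd \<alpha> or \<beta> is at least 3, so one row of that kind can be reserved in each coset; what
  remains is even and is split into even portions.\<close>

lemma split_three:
  fixes \<alpha> \<beta> n :: nat
  assumes sum: "\<alpha> + \<beta> = 3 * n" and "\<alpha> \<noteq> 1" "\<beta> \<noteq> 1"
  obtains a b c where "a + b + c = \<alpha>" "a \<le> n" "b \<le> n" "c \<le> n"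
    "odd a = odd \<alpha>" "odd b = odd \<alpha>" "odd c = odd \<alpha>"
proof -
  define d :: nat where "d = (if odd \<alpha> then 1 else 0)"
  define d' :: nat where "d' = (if odd \<beta> then 1 else 0)"
  have ge: "3 * d \<le> \<alpha>" "3 * d' \<le> \<beta>"
    using assms(2,3) by (auto simp: d_def d'_def) presburger+
  have par: "odd n = (odd \<alpha> \<noteq> odd \<beta>)"
    using arg_cong[OF sum, of even] by auto
  have "even (\<alpha> - 3 * d)"
    using ge by (auto simp: d_def)
  moreover have dd: "d + d' \<le> n"
    using ge sum by linarith
  moreover have "even (n - d - d')"
    using par dd by (auto simp: d_def d'_def)
  moreover have "\<alpha> - 3 * d \<le> 3 * (n - d - d')"
    using ge sum by simp
  ultimately obtain e1 e2 e3 where e: "e1 + e2 + e3 = \<alpha> - 3 * d" "e1 \<le> n - d - d'" "e2 \<le> n - d - d'"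
    "e3 \<le> n - d - d'" "even e1" "even e2" "even e3"
    using split_even_three by meson
  show thesis
    by (rule that[of "e1 + d" "e2 + d" "e3 + d"]) (use e ge dd in \<open>auto simp: d_def\<close>)
qed

lemma inj_on_extend:
  assumes "inj_on f {..<r}" "p \<notin> f ` {..<r}"
  shows "inj_on (f(r := p)) {..<Suc r}"
proof -
  have "(f(r := p)) ` {..<r} = f ` {..<r}"
    by (intro image_cong) auto
  moreover have "inj_on (f(r := p)) {..<r}"
    using assms by (rule inj_on_fun_updI)
  ultimately show ?thesis
    using assms(2) by (simp only: lessThan_Suc inj_on_insert) auto
qed

text \<open>\<open>J\<close> consists of the rows met when following \<open>p'\<close> under \<open>w \<mapsto> x (y\<^sup>-\<^sup>1 (\<rho> w))\<close>. This partial map is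
  injective and its range misses \<open>p\<close> and \<open>p'\<close>, so the path never closes up. With \<open>\<rho> w = c - w\<close> the
  replacement of \<open>(x, y)\<close> by \<open>(\<rho> y, \<rho> x)\<close> preserves \<open>y - x\<close>, and the choice \<open>c = p + p' + h\<close>
  makes \<open>(p, \<rho> p')\<close> a new row with difference \<open>h\<close>.\<close>

lemma reflect_matching:
  fixes x y :: "'i \<Rightarrow> 'w"
  assumes x: "inj_on x I" "x ` I \<subseteq> W" and y: "inj_on y I" "y ` I \<subseteq> W"
    and \<rho>: "\<And>w. w \<in> W \<Longrightarrow> \<rho> w \<in> W" "\<And>w. w \<in> W \<Longrightarrow> \<rho> (\<rho> w) = w"
    and p: "p \<in> W - x ` I" "p' \<in> W - x ` I" "p \<noteq> p'"
  obtains J where "J \<subseteq> I"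
    "inj_on (\<lambda>i. if i \<in> J then \<rho> (y i) else x i) I"
    "inj_on (\<lambda>i. if i \<in> J then \<rho> (x i) else y i) I"
    "p \<notin> (\<lambda>i. if i \<in> J then \<rho> (y i) else x i) ` I"
    "\<rho> p' \<notin> (\<lambda>i. if i \<in> J then \<rho> (x i) else y i) ` I"
proof -
  define r where "r = {(k, i). k \<in> I \<and> i \<in> I \<and> y i = \<rho> (x k)}"
  define J where "J = r\<^sup>* `` {i \<in> I. y i = \<rho> p'}"
  have JI: "J \<subseteq> I"
  proof
    fix i assume "i \<in> J"
    then obtain k where k: "k \<in> I" "(k, i) \<in> r\<^sup>*"
      by (auto simp: J_def)
    from k(2,1) show "i \<in> I"
      by (induction rule: rtrancl_induct) (auto simp: r_def)
  qed
  have start: "i \<in> J" if "i \<in> I" "y i = \<rho> p'" for i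
    using that by (auto simp: J_def)
  have step: "i \<in> J" if "k \<in> J" "i \<in> I" "y i = \<rho> (x k)" for i k
  proof -
    have "(k, i) \<in> r"
      using that JI by (auto simp: r_def)
    with that(1) show ?thesis
      by (auto simp: J_def intro: rtrancl_into_rtrancl)
  qed
  have inv: "y i = \<rho> p' \<or> (\<exists>k\<in>J. y i = \<rho> (x k))" if i: "i \<in> J" for i
  proof -
    obtain j where j: "j \<in> I" "y j = \<rho> p'" "(j, i) \<in> r\<^sup>*"
      using i unfolding J_def by blast
    from j(3) show ?thesis
    proof (cases rule: rtranclE)
      case base
      with j show ?thesis by simp
    next
      case (step k)
      then have "k \<in> J" using j by (auto simp: J_def)
      with step show ?thesis by (auto simp: r_def)
    qed
  qed
  have \<rho>_inj: "w = w'" if "\<rho> w = \<rho> w'" "w \<in> W" "w' \<in> W" for w w'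
    using that \<rho>(2) by metis
  have refl: "\<rho> (y i) = p' \<or> (\<exists>k\<in>J. \<rho> (y i) = x k)" if "i \<in> J" for i
  proof -
    have "x k \<in> W" if "k \<in> J" for k
      using that JI x(2) by auto
    with inv[OF that] p(2) \<rho>(2) show ?thesis
      by auto
  qed
  \<comment> \<open>A replaced entry equals \<open>p'\<close> or some \<open>x k\<close> with
    \<open>k\<close> in \<open>J\<close>, so injectivity of \<open>x\<close> separates it from the
    entries of rows outside \<open>J\<close>.\<close>
  have out: "\<rho> (y i) \<noteq> x l" if "i \<in> J" "l \<in> I" "l \<notin> J" for i l
    using refl[OF that(1)]
  proof
    assume "\<rho> (y i) = p'"
    then show ?thesis using p(2) that by auto
  next
    assume "\<exists>k\<in>J. \<rho> (y i) = x k"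
    then obtain k where "k \<in> J" "\<rho> (y i) = x k" by blast
    then show ?thesis using that JI inj_onD[OF x(1), of k l] by auto
  qed
  have out': "\<rho> (x i) \<noteq> y l" if "i \<in> J" "l \<in> I" "l \<notin> J" for i l
    using step that by metis
  have W: "x i \<in> W" "y i \<in> W" if "i \<in> I" for i
    using that x(2) y(2) by auto
  show thesis
  proof (rule that[OF JI])
    show "inj_on (\<lambda>i. if i \<in> J then \<rho> (y i) else x i) I"
    proof (rule inj_onI)
      fix i k assume "i \<in> I" "k \<in> I"
        "(if i \<in> J then \<rho> (y i) else x i) = (if k \<in> J then \<rho> (y k) else x k)"
      then show "i = k"
        using out[of i k] out[of k i] \<rho>_inj[of "y i" "y k"] W[of i] W[of k]
          inj_onD[OF x(1), of i k] inj_onD[OF y(1), of i k] by (auto split: if_splits)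
    qed
    show "inj_on (\<lambda>i. if i \<in> J then \<rho> (x i) else y i) I"
    proof (rule inj_onI)
      fix i k assume "i \<in> I" "k \<in> I"
        "(if i \<in> J then \<rho> (x i) else y i) = (if k \<in> J then \<rho> (x k) else y k)"
      then show "i = k"
        using out'[of i k] out'[of k i] \<rho>_inj[of "x i" "x k"] W[of i] W[of k]
          inj_onD[OF x(1), of i k] inj_onD[OF y(1), of i k] by (auto split: if_splits)
    qed
    show "p \<notin> (\<lambda>i. if i \<in> J then \<rho> (y i) else x i) ` I"
    proof
      assume "p \<in> (\<lambda>i. if i \<in> J then \<rho> (y i) else x i) ` I"
      then obtain i where i: "i \<in> I" "p = (if i \<in> J then \<rho> (y i) else x i)" by auto
      show False
      proof (cases "i \<in> J")
        case True
        with i refl[OF True] p JI show False by auto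
      next
        case False
        with i p show False by auto
      qed
    qed
    show "\<rho> p' \<notin> (\<lambda>i. if i \<in> J then \<rho> (x i) else y i) ` I"
    proof
      assume "\<rho> p' \<in> (\<lambda>i. if i \<in> J then \<rho> (x i) else y i) ` I"
      then obtain i where i: "i \<in> I" "\<rho> p' = (if i \<in> J then \<rho> (x i) else y i)" by auto
      show False
      proof (cases "i \<in> J")
        case True
        with i have "\<rho> p' = \<rho> (x i)" by simp
        with p W[OF i(1)] have "p' = x i" by (auto dest: \<rho>_inj)
        with p i show False by auto
      next
        case False
        with i start show False by auto
      qed
    qed
  qed
qed

section \<open>Differences of two enumerations of \<open>Z_m x Z_K\<close>\<close>

locale gen_dihedral =
  fixes m K :: int
  assumes m_pos: "0 < m" and K_pos: "0 < K" and odd_m: "odd m"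
begin

definition W :: "(int \<times> int) set" where
  "W = {0..<m} \<times> {0..<K}"

definition shift :: "int \<times> int \<Rightarrow> int \<times> int \<Rightarrow> int \<times> int" where
  "shift w h = ((fst w + fst h) mod m, (snd w + snd h) mod K)"

lemma finite_W [simp]: "finite W"
  by (simp add: W_def)

lemma card_W: "card W = nat (m * K)"
  using m_pos K_pos by (simp add: W_def nat_mult_distrib)

lemma card_W_pos: "0 < card W"
  using m_pos K_pos by (simp add: card_W)

lemma mod_W: "(a mod m, b mod K) \<in> W"
  using m_pos K_pos by (simp add: W_def)

lemma shift_in_W [simp]: "shift w h \<in> W"
  by (simp add: shift_def mod_W)

lemma W_eqI: "w = (a mod m, b mod K)" if "w \<in> W" "fst w mod m = a mod m" "snd w mod K = b mod K"
  using that by (auto simp: W_def)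

lemma partial_difference_matching:
  assumes "r < card W"
  shows "\<exists>x y. inj_on x {..<r} \<and> inj_on y {..<r} \<and> x ` {..<r} \<subseteq> W \<and> y ` {..<r} \<subseteq> W
    \<and> (\<forall>i<r. y i = shift (x i) (h i))"
  using assms
proof (induction r)
  case 0
  then show ?case by simp
next
  case (Suc r)
  then obtain x y where x: "inj_on x {..<r}" "x ` {..<r} \<subseteq> W"
    and y: "inj_on y {..<r}" "y ` {..<r} \<subseteq> W" and xy: "\<And>i. i < r \<Longrightarrow> y i = shift (x i) (h i)"
    by auto
  have "card (W - x ` {..<r}) = card W - r"
    using x by (simp add: card_Diff_subset card_image)
  then have "2 \<le> card (W - x ` {..<r})"
    using Suc.prems by simp
  then obtain p p' where p: "p \<in> W - x ` {..<r}" "p' \<in> W - x ` {..<r}" "p \<noteq> p'"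
    by (meson card_2_iff' obtain_subset_with_card_n subsetD)
  define \<rho> where "\<rho> w = ((fst p + fst p' + fst (h r) - fst w) mod m,
                           (snd p + snd p' + snd (h r) - snd w) mod K)" for w
  have \<rho>W: "\<rho> w \<in> W" for w by (simp add: \<rho>_def mod_W)
  have \<rho>\<rho>: "\<rho> (\<rho> w) = w" if "w \<in> W" for w
    using that by (auto simp: \<rho>_def W_def mod_simps)
  obtain J where J: "J \<subseteq> {..<r}"
    "inj_on (\<lambda>i. if i \<in> J then \<rho> (y i) else x i) {..<r}"
    "inj_on (\<lambda>i. if i \<in> J then \<rho> (x i) else y i) {..<r}"
    "p \<notin> (\<lambda>i. if i \<in> J then \<rho> (y i) else x i) ` {..<r}"
    "\<rho> p' \<notin> (\<lambda>i. if i \<in> J then \<rho> (x i) else y i) ` {..<r}"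
    by (rule reflect_matching[OF x y \<rho>W \<rho>\<rho> p])
  define x' where "x' = (\<lambda>i. if i \<in> J then \<rho> (y i) else x i)(r := p)"
  define y' where "y' = (\<lambda>i. if i \<in> J then \<rho> (x i) else y i)(r := \<rho> p')"
  have "inj_on x' {..<Suc r}"
    unfolding x'_def using J(2,4) by (rule inj_on_extend)
  moreover have "inj_on y' {..<Suc r}"
    unfolding y'_def using J(3,5) by (rule inj_on_extend)
  moreover have "x' i \<in> W" "y' i \<in> W" if "i < Suc r" for i
    using x(2) y(2) p(1) \<rho>W that by (auto simp: x'_def y'_def less_Suc_eq image_subset_iff)
  then have "x' ` {..<Suc r} \<subseteq> W" "y' ` {..<Suc r} \<subseteq> W"
    by blast+
  moreover have "y' i = shift (x' i) (h i)" if "i < Suc r" for i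
  proof (cases "i = r")
    case True
    then show ?thesis by (simp add: x'_def y'_def \<rho>_def shift_def algebra_simps)
  next
    case False
    with that have "i < r" by simp
    \<comment> \<open>Reflection turns \<open>y - x = h\<close> into
      \<open>\<rho> x - \<rho> y = h\<close>, so the exchanged rows keep their differences.\<close>
    have "(c - a) mod q = ((c - (a + b) mod q) mod q + b) mod q" for a b c q :: int
      by (simp add: mod_simps)
    then show ?thesis
      using False xy[OF \<open>i < r\<close>] by (simp add: x'_def y'_def \<rho>_def shift_def)
  qed
  ultimately show ?case by blast
qed

text \<open>M. Hall, A combinatorial problem on abelian groups (1952), for the group \<open>\<int>\<^sub>m \<times> \<int>\<^sub>K\<close>.\<close>

lemma difference_matching:
  assumes h: "m dvd (\<Sum>i<card W. fst (h i))" "K dvd (\<Sum>i<card W. snd (h i))"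
  obtains x y where "bij_betw x {..<card W} W" "bij_betw y {..<card W} W"
    "\<And>i. i < card W \<Longrightarrow> y i = shift (x i) (h i)"
proof -
  \<comment> \<open>Match all rows but one; the last pair \<open>(p, s)\<close> is then forced by
    bijectivity.\<close>
  obtain r where r: "card W = Suc r"
    using card_W_pos gr0_conv_Suc by auto
  then obtain x y where x: "inj_on x {..<r}" "x ` {..<r} \<subseteq> W"
    and y: "inj_on y {..<r}" "y ` {..<r} \<subseteq> W" and xy: "\<And>i. i < r \<Longrightarrow> y i = shift (x i) (h i)"
    using partial_difference_matching[of r h] by auto
  have extend: "\<exists>p. bij_betw (u(r := p)) {..<Suc r} W"
    if u: "inj_on u {..<r}" "u ` {..<r} \<subseteq> W" for u
  proof -
    have "card (W - u ` {..<r}) = 1"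
      using u r by (simp add: card_Diff_subset card_image)
    then obtain p where p: "W - u ` {..<r} = {p}" by (auto simp: card_1_singleton_iff)
    have img: "(u(r := p)) ` {..<r} = u ` {..<r}" by (intro image_cong) auto
    have "p \<notin> u ` {..<r}" using p by blast
    then have "inj_on (u(r := p)) {..<Suc r}"
      by (rule inj_on_extend[OF u(1)])
    moreover have "(u(r := p)) ` {..<Suc r} = W"
      unfolding lessThan_Suc image_insert img using p u(2) by auto
    ultimately show ?thesis unfolding bij_betw_def by blast
  qed
  obtain p where p: "bij_betw (x(r := p)) {..<Suc r} W" using extend[OF x] by blast
  obtain s where s: "bij_betw (y(r := s)) {..<Suc r} W" using extend[OF y] by blast
  \<comment> \<open>Both enumerations have the same sum over \<open>W\<close>, so all differences
    together sum to zero, and this determines the last one.\<close>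
  have total: "q dvd F s - F p - H r"
    if F: "\<And>i. i < r \<Longrightarrow> F (y i) mod q = (F (x i) + H i) mod q" and H: "q dvd (\<Sum>i<Suc r. H i)"
    for F :: "int \<times> int \<Rightarrow> int" and H and q :: int
  proof -
    have "(\<Sum>i<Suc r. F ((x(r := p)) i)) = (\<Sum>w\<in>W. F w)"
      using p by (rule sum.reindex_bij_betw)
    moreover have "(\<Sum>i<Suc r. F ((y(r := s)) i)) = (\<Sum>w\<in>W. F w)"
      using s by (rule sum.reindex_bij_betw)
    ultimately have "F p + (\<Sum>i<r. F (x i)) = F s + (\<Sum>i<r. F (y i))"
      by (simp add: lessThan_Suc)
    then have "F s - F p - H r = - (\<Sum>i<r. F (y i) - (F (x i) + H i)) - (\<Sum>i<Suc r. H i)"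
      by (simp add: sum_subtractf sum.distrib)
    moreover have "q dvd (\<Sum>i<r. F (y i) - (F (x i) + H i))"
      using F by (intro dvd_sum) (auto simp: mod_eq_dvd_iff)
    ultimately show ?thesis using H by (simp only: dvd_diff dvd_minus_iff)
  qed
  have sW: "s \<in> W" using bij_betwE[OF s] by (metis fun_upd_same lessThan_iff lessI)
  have "m dvd fst s - fst p - fst (h r)"
    by (rule total[where H = "\<lambda>i. fst (h i)" and F = fst])
      (use xy h(1) r in \<open>simp_all add: shift_def\<close>)
  then have f: "fst s mod m = (fst p + fst (h r)) mod m"
    by (simp add: mod_eq_dvd_iff algebra_simps)
  have "K dvd snd s - snd p - snd (h r)"
    by (rule total[where H = "\<lambda>i. snd (h i)" and F = snd])
      (use xy h(2) r in \<open>simp_all add: shift_def\<close>)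
  then have g: "snd s mod K = (snd p + snd (h r)) mod K"
    by (simp add: mod_eq_dvd_iff algebra_simps)
  have "s = shift p (h r)"
    using W_eqI[OF sW f g] by (simp add: shift_def)
  then have "(y(r := s)) i = shift ((x(r := p)) i) (h i)" if "i < card W" for i
    using that xy r by (auto simp: less_Suc_eq)
  with p s show thesis
    by (intro that[of "x(r := p)" "y(r := s)"]) (simp_all only: r)
qed

section \<open>Adjusting the last column\<close>

abbreviation add :: "delt \<Rightarrow> delt \<Rightarrow> delt" where
  "add \<equiv> dih_add m (2 * K)"

text \<open>Accepts unreduced integers, so that sums can be computed over the integers and reduced
  afterwards.\<close>

definition el :: "bool \<Rightarrow> int \<Rightarrow> int \<Rightarrow> delt" where
  [simp]: "el t a b = (a mod m, b mod (2 * K), t)"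

definition coset :: "bool \<Rightarrow> int \<Rightarrow> delt set" where
  "coset t p = {x \<in> dih_carrier m (2 * K). snd (snd x) = t \<and> fst (snd x) mod 2 = p}"

text \<open>The isomorphism of \<open>Z_m x Z_K\<close> onto \<open>2\<Gamma>\<close>; the doubling
  is why orders are governed by \<open>K\<close> and not by \<open>2 * K\<close>.\<close>

definition emb :: "int \<times> int \<Rightarrow> delt" where
  "emb w = el False (fst w) (2 * snd w)"

lemma add_el:
  "add (el s a b) (el t a' b') = (if s then el (s \<noteq> t) (a - a') (b - b') else el (s \<noteq> t) (a + a') (b + b'))"
  by (simp add: dih_add_def mod_simps)

lemma zero_eq_emb: "dih_zero = emb (0, 0)"
  by (simp add: dih_zero_def emb_def)

lemma double_mod: "(2 * c) mod (2 * K) = 2 * (c mod K)" for c :: int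
  by simp

lemma mult_el: "dih_mult m (2 * K) j (el False a b) = el False (int j * a) (int j * b)"
proof (induction j)
  case 0
  then show ?case by (simp add: dih_zero_def)
next
  case (Suc j)
  then show ?case by (simp only: dih_mult.simps add_el) (simp add: algebra_simps)
qed

lemma Least_dvd_mult:
  fixes q a :: int
  assumes "0 < q" "coprime a q"
  shows "(LEAST j. 0 < j \<and> q dvd int j * a) = nat q"
proof (rule Least_equality)
  show "0 < nat q \<and> q dvd int (nat q) * a"
    using assms by simp
  show "nat q \<le> j" if "0 < j \<and> q dvd int j * a" for j
  proof -
    have "q dvd int j"
      using that assms by (simp add: coprime_commute coprime_dvd_mult_left_iff)
    then show ?thesis
      using that zdvd_imp_le[of q "int j"] by (simp add: nat_le_iff)
  qed
qed

lemma ord_emb: "dih_ord m (2 * K) (emb (a, c)) = (LEAST j. 0 < j \<and> m dvd int j * a \<and> K dvd int j * c)"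
proof -
  have "dih_mult m (2 * K) j (emb (a, c)) = dih_zero \<longleftrightarrow> m dvd int j * a \<and> K dvd int j * c" for j
  proof -
    have "dih_mult m (2 * K) j (emb (a, c)) = el False (int j * a) (2 * (int j * c))"
      by (simp only: emb_def mult_el fst_conv snd_conv mult.left_commute)
    then show ?thesis
      by (auto simp: dih_zero_def mod_eq_0_iff_dvd)
  qed
  then show ?thesis by (simp add: dih_ord_def)
qed

lemma ord_emb_left: "coprime a m \<Longrightarrow> dih_ord m (2 * K) (emb (a, 0)) = nat m"
  using Least_dvd_mult[OF m_pos] by (simp add: ord_emb)

lemma ord_emb_right: "coprime c K \<Longrightarrow> dih_ord m (2 * K) (emb (0, c)) = nat K"
  using Least_dvd_mult[OF K_pos] by (simp add: ord_emb)

lemma bij_coset: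
  assumes "p = 0 \<or> p = 1"
  shows "bij_betw (\<lambda>w. el t (fst w) (2 * snd w + p)) W (coset t p)"
proof (rule bij_betw_byWitness[where f' = "\<lambda>x. (fst x, fst (snd x) div 2)"])
  show "\<forall>w\<in>W. (fst (el t (fst w) (2 * snd w + p)), fst (snd (el t (fst w) (2 * snd w + p))) div 2) = w"
    using assms by (auto simp: W_def)
  show "\<forall>x\<in>coset t p. el t (fst (fst x, fst (snd x) div 2)) (2 * snd (fst x, fst (snd x) div 2) + p) = x"
    by (auto simp: coset_def dih_carrier_def)
  show "(\<lambda>w. el t (fst w) (2 * snd w + p)) ` W \<subseteq> coset t p"
    using assms by (auto simp: W_def coset_def dih_carrier_def)
  show "(\<lambda>x. (fst x, fst (snd x) div 2)) ` coset t p \<subseteq> W"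
    by (auto simp: W_def coset_def dih_carrier_def)
qed

text \<open>Alternating signs cancel in pairs. For odd length entry 0 is \<open>a\<close> and the
  signs after it cancel, so the list sums to \<open>a\<close> and consists of units as soon as
  \<open>a\<close> is one.\<close>

definition alt :: "nat \<Rightarrow> int \<Rightarrow> nat \<Rightarrow> int" where
  "alt n a i = (if odd n \<and> i = 0 then a else (- 1) ^ i)"

text \<open>Describes the sums attained by lists of the form \<open>alt\<close> whose entries are
  prime to \<open>q\<close>.\<close>

definition admissible :: "nat \<Rightarrow> int \<Rightarrow> int \<Rightarrow> bool" where
  "admissible n q a \<longleftrightarrow> (if odd n then coprime a q else a = 0)"

lemma sum_alt: "admissible n q a \<Longrightarrow> (\<Sum>i<n. alt n a i) = a"
proof -
  assume adm: "admissible n q a"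
  have even: "(\<Sum>i<r. (- 1) ^ i :: int) = (if even r then 0 else 1)" for r
    by (induction r) auto
  show ?thesis
  proof (cases "odd n")
    case True
    then obtain r where r: "n = Suc r" "even r" by (cases n) auto
    have "(\<Sum>i<r. (- 1) ^ Suc i :: int) = - (\<Sum>i<r. (- 1) ^ i)"
      by (simp add: sum_negf)
    then show ?thesis
      using r even[of r] by (simp add: sum.lessThan_Suc_shift alt_def del: sum.lessThan_Suc)
  next
    case False
    then show ?thesis using adm even[of n] by (simp add: alt_def admissible_def)
  qed
qed

lemma coprime_alt: "coprime (alt n a i) q" if "admissible n q a"
  using that by (auto simp: alt_def admissible_def)

lemma bij_shift: "bij_betw (\<lambda>w. shift w d) W W"
  by (rule bij_betw_byWitness[where f' = "\<lambda>w. shift w (- fst d, - snd d)"])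
    (auto simp: shift_def W_def mod_simps m_pos K_pos)

text \<open>Within the rows that end in a given coset, only the last entries are permuted; the
  sign \<open>\<epsilon>\<close> accounts for an entry being subtracted after an odd number of reflections.\<close>

lemma adjust_coset:
  assumes f: "bij_betw f J (coset t p)" and p: "p = 0 \<or> p = 1" and i0: "i0 \<in> J"
    and ab: "\<alpha> + \<beta> = nat (m * K)"
    and adm: "admissible \<alpha> m (fst s)" "admissible \<beta> K (snd s)"
  obtains f' T where "bij_betw f' J (coset t p)"
    "\<And>i a b. i \<in> J \<Longrightarrow> add (el t a b) (f i) = (if i = i0 then emb s else dih_zero) \<Longrightarrow>
       add (el t a b) (f' i) = emb (T i)"
    "image_mset (\<lambda>i. dih_ord m (2 * K) (emb (T i))) (mset_set J)
       = replicate_mset \<alpha> (nat m) + replicate_mset \<beta> (nat K)"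
proof -
  define \<epsilon> :: int where "\<epsilon> = (if t then - 1 else 1)"
  \<comment> \<open>Target totals: \<alpha> units in the first component, then \<beta> units in the
    second, with overall sum \<open>s\<close>. The present totals are \<open>s\<close> in one row
    and zero elsewhere, so the changes \<open>h\<close> sum to zero.\<close>
  define \<tau> where "\<tau> i = (if i < \<alpha> then (alt \<alpha> (fst s) i, 0) else (0, alt \<beta> (snd s) (i - \<alpha>)))" for i
  define h where "h i = (\<epsilon> * (fst (\<tau> i) - (if i = 0 then fst s else 0)),
    \<epsilon> * (snd (\<tau> i) - (if i = 0 then snd s else 0)))" for i
  have cW: "card W = \<alpha> + \<beta>" using ab by (simp add: card_W)
  have split: "(\<Sum>i<\<alpha> + \<beta>. F i) = (\<Sum>i<\<alpha>. F i) + (\<Sum>i<\<beta>. F (\<alpha> + i))" for F :: "nat \<Rightarrow> int"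
    by (induction \<beta>) (simp_all add: algebra_simps)
  have pos: "0 < \<alpha> + \<beta>" using card_W_pos cW by simp
  have z0: "(\<Sum>i<\<alpha> + \<beta>. if i = 0 then u else 0) = u" for u :: int
    using pos by simp
  have s1: "(\<Sum>i<card W. fst (h i)) = 0"
  proof -
    have "(\<Sum>i<\<alpha> + \<beta>. fst (\<tau> i)) = fst s"
      by (subst split) (simp add: \<tau>_def sum_alt[OF adm(1)])
    then show ?thesis
      using z0[of "fst s"] by (simp only: cW h_def fst_conv snd_conv sum_distrib_left[symmetric] sum_subtractf) simp
  qed
  have s2: "(\<Sum>i<card W. snd (h i)) = 0"
  proof -
    have "(\<Sum>i<\<alpha> + \<beta>. snd (\<tau> i)) = snd s"
      by (subst split) (simp add: \<tau>_def sum_alt[OF adm(2)])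
    then show ?thesis
      using z0[of "snd s"] by (simp only: cW h_def fst_conv snd_conv sum_distrib_left[symmetric] sum_subtractf) simp
  qed
  obtain x y where x: "bij_betw x {..<card W} W" and y: "bij_betw y {..<card W} W"
    and xy: "\<And>i. i < card W \<Longrightarrow> y i = shift (x i) (h i)"
    using difference_matching[of h] s1 s2 by auto
  let ?c = "\<lambda>w. el t (fst w) (2 * snd w + p)"
  define z where "z = inv_into W ?c \<circ> f"
  have z: "bij_betw z J W"
    unfolding z_def using f bij_betw_inv_into[OF bij_coset[OF p]] by (rule bij_betw_trans)
  have fz: "f i = ?c (z i)" if "i \<in> J" for i
    using that bij_betwE[OF f] bij_betw_inv_into_right[OF bij_coset[OF p, of t], of "f i"]
    by (simp add: z_def)
  \<comment> \<open>\<open>h\<close> charges the present defect \<open>s\<close> to index 0, so both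
    enumerations are translated until index 0 carries the old entry of row \<open>i0\<close>. A
    common translation keeps the differences.\<close>
  define d where "d = (fst (z i0) - fst (x 0), snd (z i0) - snd (x 0))"
  define X where "X = (\<lambda>w. shift w d) \<circ> x"
  define Y where "Y = (\<lambda>w. shift w d) \<circ> y"
  have X: "bij_betw X {..<card W} W" and Y: "bij_betw Y {..<card W} W"
    unfolding X_def Y_def using x y bij_shift by (blast intro: bij_betw_trans)+
  have XY: "Y i = shift (X i) (h i)" if "i < card W" for i
    using xy[OF that] by (simp add: X_def Y_def shift_def mod_simps add_ac)
  define \<theta> where "\<theta> = inv_into {..<card W} X \<circ> z"
  have \<theta>: "bij_betw \<theta> J {..<card W}"
    unfolding \<theta>_def using z bij_betw_inv_into[OF X] by (rule bij_betw_trans)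
  have X\<theta>: "X (\<theta> i) = z i" if "i \<in> J" for i
    using that bij_betwE[OF z] X by (simp add: \<theta>_def bij_betw_inv_into_right)
  have zi0: "z i0 \<in> W" using bij_betwE[OF z] i0 by blast
  have "X 0 = z i0"
    using zi0 by (auto simp: X_def shift_def d_def W_def)
  then have \<theta>0: "\<theta> i = 0 \<longleftrightarrow> i = i0" if "i \<in> J" for i
    using X\<theta>[OF i0] X\<theta>[OF that] bij_betw_imp_inj_on[OF X] bij_betw_imp_inj_on[OF z] bij_betwE[OF \<theta>]
      card_W_pos that i0 by (metis inj_on_def lessThan_iff)
  define z' where "z' = Y \<circ> \<theta>"
  have z': "bij_betw z' J W"
    unfolding z'_def using \<theta> Y by (rule bij_betw_trans)
  have z'z: "z' i = shift (z i) (h (\<theta> i))" if "i \<in> J" for i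
    using XY[of "\<theta> i"] X\<theta>[OF that] bij_betwE[OF \<theta>] that by (simp add: z'_def)
  show thesis
  proof (rule that)
    show "bij_betw (?c \<circ> z') J (coset t p)"
      using z' bij_coset[OF p] by (rule bij_betw_trans)
    show "add (el t a b) ((?c \<circ> z') i) = emb ((\<tau> \<circ> \<theta>) i)"
      if i: "i \<in> J" and sum: "add (el t a b) (f i) = (if i = i0 then emb s else dih_zero)" for i a b
    proof -
      let ?s = "if i = i0 then s else (0, 0)"
      have e: "add (el t a b) (?c w) = el False (a + \<epsilon> * fst w) (b + \<epsilon> * (2 * snd w + p))" for w
        by (simp only: add_el) (simp add: \<epsilon>_def algebra_simps)
      have "el False (a + \<epsilon> * fst (z i)) (b + \<epsilon> * (2 * snd (z i) + p)) = emb ?s"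
        using sum unfolding fz[OF i] e zero_eq_emb by (cases "i = i0") (simp_all only: if_True if_False refl)
      then have s: "(a + \<epsilon> * fst (z i)) mod m = fst ?s mod m"
        "(b + \<epsilon> * (2 * snd (z i) + p)) mod (2 * K) = (2 * snd ?s) mod (2 * K)"
        by (auto simp: emb_def)
      have h: "h (\<theta> i) = (\<epsilon> * (fst (\<tau> (\<theta> i)) - fst ?s), \<epsilon> * (snd (\<tau> (\<theta> i)) - snd ?s))"
        using \<theta>0[OF i] by (simp add: h_def)
      have \<epsilon>: "\<epsilon> * (\<epsilon> * u) = u" for u by (simp add: \<epsilon>_def)
      have single: "(c + \<epsilon> * (u mod q)) mod q = (c + \<epsilon> * u) mod q" for c u q
        by (metis mod_add_right_eq mod_mult_right_eq)
      have "(a + \<epsilon> * fst (z' i)) mod m = (a + \<epsilon> * (fst (z i) + fst (h (\<theta> i)))) mod m"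
        unfolding z'z[OF i] shift_def fst_conv by (rule single)
      also have "\<dots> = ((a + \<epsilon> * fst (z i)) mod m + (fst (\<tau> (\<theta> i)) - fst ?s)) mod m"
        by (simp add: h distrib_left \<epsilon> add.assoc mod_simps)
      also have "\<dots> = fst (\<tau> (\<theta> i)) mod m"
        unfolding s(1) by (simp add: mod_simps)
      finally have 1: "(a + \<epsilon> * fst (z' i)) mod m = fst (\<tau> (\<theta> i)) mod m" .
      have nest: "(b + \<epsilon> * (u mod q + p)) mod q = (b + \<epsilon> * (u + p)) mod q" for u q
        using single[of "b + \<epsilon> * p" u q] by (simp only: distrib_left add_ac)
      have "2 * snd (z' i) = (2 * (snd (z i) + snd (h (\<theta> i)))) mod (2 * K)"
        unfolding z'z[OF i] shift_def snd_conv by (rule double_mod[symmetric])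
      then have "(b + \<epsilon> * (2 * snd (z' i) + p)) mod (2 * K)
          = (b + \<epsilon> * (2 * (snd (z i) + snd (h (\<theta> i))) + p)) mod (2 * K)"
        by (simp only: nest)
      also have "\<dots> = ((b + \<epsilon> * (2 * snd (z i) + p)) mod (2 * K) + 2 * (snd (\<tau> (\<theta> i)) - snd ?s)) mod (2 * K)"
        unfolding mod_add_left_eq by (rule arg_cong[where f = "\<lambda>u. u mod (2 * K)"]) (simp add: h \<epsilon>_def)
      also have "\<dots> = (2 * snd (\<tau> (\<theta> i))) mod (2 * K)"
        unfolding s(2) mod_add_left_eq by (simp add: right_diff_distrib)
      finally have 2: "(b + \<epsilon> * (2 * snd (z' i) + p)) mod (2 * K) = (2 * snd (\<tau> (\<theta> i))) mod (2 * K)" .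
      show ?thesis
        unfolding comp_def e by (simp add: emb_def 1 2)
    qed
    have ord: "dih_ord m (2 * K) (emb (\<tau> i)) = (if i < \<alpha> then nat m else nat K)" for i
      using coprime_alt[OF adm(1)] coprime_alt[OF adm(2)] by (simp add: \<tau>_def ord_emb_left ord_emb_right)
    have "image_mset (\<lambda>i. dih_ord m (2 * K) (emb ((\<tau> \<circ> \<theta>) i))) (mset_set J)
        = image_mset (\<lambda>i. dih_ord m (2 * K) (emb (\<tau> i))) (image_mset \<theta> (mset_set J))"
      by (simp add: multiset.map_comp comp_def)
    also have "image_mset \<theta> (mset_set J) = mset_set {..<\<alpha> + \<beta>}"
      using \<theta> cW by (simp add: image_mset_mset_set bij_betw_def)
    also have "mset_set {..<\<alpha> + \<beta>} = mset_set {..<\<alpha>} + mset_set {\<alpha>..<\<alpha> + \<beta>}"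
      by (subst mset_set_Union[symmetric]) (auto intro: arg_cong[where f = mset_set])
    also have "image_mset (\<lambda>i. dih_ord m (2 * K) (emb (\<tau> i))) \<dots>
        = image_mset (\<lambda>i. nat m) (mset_set {..<\<alpha>}) + image_mset (\<lambda>i. nat K) (mset_set {\<alpha>..<\<alpha> + \<beta>})"
      unfolding image_mset_union ord by (intro arg_cong2[where f = "(+)"] image_mset_cong) auto
    also have "\<dots> = replicate_mset \<alpha> (nat m) + replicate_mset \<beta> (nat K)"
      by (simp add: image_mset_const_eq)
    finally show "image_mset (\<lambda>i. dih_ord m (2 * K) (emb ((\<tau> \<circ> \<theta>) i))) (mset_set J)
        = replicate_mset \<alpha> (nat m) + replicate_mset \<beta> (nat K)" .
  qed
qed

section \<open>Arrays with one exceptional row per coset\<close>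

abbreviation S :: "delt set" where
  "S \<equiv> dih_carrier m (2 * K) - dih_two m (2 * K)"

text \<open>Prefix sums over an arbitrary index type; the rows are numbered only in
  \<open>RSM_of_array\<close>.\<close>

definition total :: "('i \<Rightarrow> nat \<Rightarrow> delt) \<Rightarrow> nat \<Rightarrow> 'i \<Rightarrow> delt" where
  "total M l i = foldl add dih_zero (map (M i) [0..<l])"

lemma total_Suc: "total M (Suc l) i = add (total M l i) (M i l)"
  by (simp add: total_def)

lemma total_0: "total M 0 i = dih_zero"
  by (simp add: total_def)

lemma S_eq: "S = coset False 1 \<union> (coset True 0 \<union> coset True 1)"
proof (rule set_eqI)
  fix x :: delt
  obtain a b t where x: "x = (a, b, t)" by (metis prod.exhaust)
  show "x \<in> S \<longleftrightarrow> x \<in> coset False 1 \<union> (coset True 0 \<union> coset True 1)"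
    unfolding x by (cases t; cases "even b")
      (simp_all add: coset_def dih_two_def even_iff_mod_2_eq_zero odd_iff_mod_2_eq_one)
qed

lemma coset_disjoint: "(t, p) \<noteq> (t', p') \<Longrightarrow> coset t p \<inter> coset t' p' = {}"
  by (auto simp: coset_def)

lemma finite_coset: "p = 0 \<or> p = 1 \<Longrightarrow> finite (coset t p)"
  using bij_betw_finite[OF bij_coset[of p t]] by simp

lemma finite_S: "finite S"
  unfolding S_eq by (simp add: finite_coset)

lemma total_form: "\<exists>t a b. total M l i = el t a b"
proof (cases l)
  case 0
  then show ?thesis by (intro exI[of _ False] exI[of _ 0]) (simp add: total_0 dih_zero_def)
next
  case (Suc k)
  obtain a b t where x: "total M k i = (a, b, t)" by (metis prod.exhaust)
  obtain a' b' t' where y: "M i k = (a', b', t')" by (metis prod.exhaust)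
  show ?thesis
    unfolding Suc total_Suc x y by (auto simp: dih_add_def)
qed

lemma add_flag: "snd (snd (add x y)) = (snd (snd x) \<noteq> snd (snd y))"
  by (auto simp: dih_add_def split: prod.splits)

lemma admissible_cong: "odd n = odd n' \<Longrightarrow> admissible n q a = admissible n' q a"
  by (simp add: admissible_def)

text \<open>The columns are \<open>0..l\<close>. Admissibility depends on \<alpha> and \<beta> only
  through their parities, so the exceptional total \<open>s\<close> suits every share of the rows
  that has these parities.\<close>

definition defect_array :: "nat \<Rightarrow> nat \<Rightarrow> nat \<Rightarrow> 'i set \<Rightarrow> ('i \<Rightarrow> nat \<Rightarrow> delt) \<Rightarrow> bool" where
  "defect_array l \<alpha> \<beta> I M \<longleftrightarrow> (\<forall>j\<le>l. bij_betw (\<lambda>i. M i j) I S) \<and>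
     (\<forall>(t, p)\<in>{(False, 1), (True, 0), (True, 1)}. \<exists>i0\<in>I. \<exists>s. M i0 l \<in> coset t p
        \<and> total M (Suc l) i0 = emb s \<and> admissible \<alpha> m (fst s) \<and> admissible \<beta> K (snd s)
        \<and> (\<forall>i\<in>I - {i0}. M i l \<in> coset t p \<longrightarrow> total M (Suc l) i = dih_zero))"

lemma defect_array_adjust_coset:
  assumes D: "defect_array l \<alpha> \<beta> I M" and tp: "(t, p) \<in> {(False, 1), (True, 0), (True, 1)}"
    and par: "odd \<alpha>' = odd \<alpha>" "odd \<beta>' = odd \<beta>" and ab: "\<alpha>' + \<beta>' = nat (m * K)"
  shows "\<exists>f. bij_betw f {i \<in> I. M i l \<in> coset t p} (coset t p) \<and>
    image_mset (\<lambda>i. dih_ord m (2 * K) (add (total M l i) (f i))) (mset_set {i \<in> I. M i l \<in> coset t p})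
      = replicate_mset \<alpha>' (nat m) + replicate_mset \<beta>' (nat K)"
proof -
  let ?J = "{i \<in> I. M i l \<in> coset t p}"
  have col: "bij_betw (\<lambda>i. M i l) I S" using D by (simp add: defect_array_def)
  have "coset t p \<subseteq> (\<lambda>i. M i l) ` I"
    unfolding bij_betw_imp_surj_on[OF col] S_eq using tp by auto
  then have "(\<lambda>i. M i l) ` ?J = coset t p" by blast
  then have bij: "bij_betw (\<lambda>i. M i l) ?J (coset t p)"
    by (intro bij_betw_subset[OF col]) blast+
  have p: "p = 0 \<or> p = 1" using tp by auto
  obtain i0 s where i0: "i0 \<in> I" "M i0 l \<in> coset t p" "total M (Suc l) i0 = emb s"
    and s: "admissible \<alpha> m (fst s)" "admissible \<beta> K (snd s)"
    and zero: "\<And>i. i \<in> I \<Longrightarrow> i \<noteq> i0 \<Longrightarrow> M i l \<in> coset t p \<Longrightarrow> total M (Suc l) i = dih_zero"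
    using D tp unfolding defect_array_def by fast
  have "i0 \<in> ?J" using i0 by simp
  moreover have "admissible \<alpha>' m (fst s)" "admissible \<beta>' K (snd s)"
    using s par admissible_cong by blast+
  ultimately obtain f T where f: "bij_betw f ?J (coset t p)"
    and T: "\<And>i a b. i \<in> ?J \<Longrightarrow> add (el t a b) (M i l) = (if i = i0 then emb s else dih_zero) \<Longrightarrow>
       add (el t a b) (f i) = emb (T i)"
    and ms: "image_mset (\<lambda>i. dih_ord m (2 * K) (emb (T i))) (mset_set ?J)
       = replicate_mset \<alpha>' (nat m) + replicate_mset \<beta>' (nat K)"
    using adjust_coset[OF bij p _ ab, of i0 s] by blast
  have "add (total M l i) (f i) = emb (T i)" if i: "i \<in> ?J" for i
  proof -
    from total_form[of M l i] obtain t' a b where e: "total M l i = el t' a b"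
      by (elim exE)
    have "add (total M l i) (M i l) = (if i = i0 then emb s else dih_zero)"
      using i0(3) zero i by (auto simp: total_Suc)
    then have tot: "add (el t' a b) (M i l) = (if i = i0 then emb s else dih_zero)"
      by (simp only: e)
    \<comment> \<open>A total in \<open>2\<Gamma>\<close> is a rotation, so the prefix and the last
      entry carry the same flag. This fixes the sign with which \<open>adjust_coset\<close>
      works.\<close>
    then have "snd (snd (add (el t' a b) (M i l))) = False"
      by (simp add: emb_def dih_zero_def)
    then have "t' = t" using i by (simp add: add_flag coset_def)
    with tot T[OF i] e show ?thesis by simp
  qed
  moreover have fin: "finite ?J"
    using bij_betw_finite[OF bij] finite_coset[OF p] by blast
  ultimately have "image_mset (\<lambda>i. dih_ord m (2 * K) (add (total M l i) (f i))) (mset_set ?J)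
      = image_mset (\<lambda>i. dih_ord m (2 * K) (emb (T i))) (mset_set ?J)"
    using fin by (intro image_mset_cong) simp
  with f ms show ?thesis by auto
qed

lemma defect_array_adjust:
  assumes D: "defect_array l \<alpha> \<beta> I M"
    and ab: "\<alpha> + \<beta> = 3 * nat (m * K)" "\<alpha> \<noteq> 1" "\<beta> \<noteq> 1"
  shows "\<exists>M'. (\<forall>j\<le>l. bij_betw (\<lambda>i. M' i j) I S) \<and>
    image_mset (\<lambda>i. dih_ord m (2 * K) (total M' (Suc l) i)) (mset_set I)
      = replicate_mset \<alpha> (nat m) + replicate_mset \<beta> (nat K)"
proof -
  let ?n = "nat (m * K)"
  obtain a b c where abc: "a + b + c = \<alpha>" "a \<le> ?n" "b \<le> ?n" "c \<le> ?n"
    "odd a = odd \<alpha>" "odd b = odd \<alpha>" "odd c = odd \<alpha>"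
    using split_three[OF ab] by blast
  \<comment> \<open>By the sum condition \<open>?n\<close> has the parity of \<alpha> + \<beta>, so
    a share with the parity of \<alpha> leaves a complement with the parity of \<beta>.\<close>
  have par: "odd (?n - x) = odd \<beta>" if "x \<le> ?n" "odd x = odd \<alpha>" for x
    using that arg_cong[OF ab(1), of even] by auto
  define J where "J t p = {i \<in> I. M i l \<in> coset t p}" for t p
  obtain fa where fa: "bij_betw fa (J False 1) (coset False 1)"
    "image_mset (\<lambda>i. dih_ord m (2 * K) (add (total M l i) (fa i))) (mset_set (J False 1))
      = replicate_mset a (nat m) + replicate_mset (?n - a) (nat K)"
    using defect_array_adjust_coset[OF D _ abc(5) par[OF abc(2,5)], of False 1] abc(2)
    unfolding J_def by auto
  obtain fb where fb: "bij_betw fb (J True 0) (coset True 0)"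
    "image_mset (\<lambda>i. dih_ord m (2 * K) (add (total M l i) (fb i))) (mset_set (J True 0))
      = replicate_mset b (nat m) + replicate_mset (?n - b) (nat K)"
    using defect_array_adjust_coset[OF D _ abc(6) par[OF abc(3,6)], of True 0] abc(3)
    unfolding J_def by auto
  obtain fc where fc: "bij_betw fc (J True 1) (coset True 1)"
    "image_mset (\<lambda>i. dih_ord m (2 * K) (add (total M l i) (fc i))) (mset_set (J True 1))
      = replicate_mset c (nat m) + replicate_mset (?n - c) (nat K)"
    using defect_array_adjust_coset[OF D _ abc(7) par[OF abc(4,7)], of True 1] abc(4)
    unfolding J_def by auto
  define F where "F i = (if i \<in> J False 1 then fa i else if i \<in> J True 0 then fb i else fc i)" for i
  have disj: "J t p \<inter> J t' p' = {}" if "(t, p) \<noteq> (t', p')" for t p t' p'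
    using coset_disjoint[OF that] by (auto simp: J_def)
  have Fa: "F i = fa i" if "i \<in> J False 1" for i using that by (simp add: F_def)
  have Fb: "F i = fb i" if "i \<in> J True 0" for i
    using that disj[of False 1 True 0] by (auto simp: F_def)
  have Fc: "F i = fc i" if "i \<in> J True 1" for i
    using that disj[of False 1 True 1] disj[of True 0 True 1] by (auto simp: F_def)
  have bij: "\<And>j. j \<le> l \<Longrightarrow> bij_betw (\<lambda>i. M i j) I S" using D by (simp add: defect_array_def)
  have I: "I = J False 1 \<union> (J True 0 \<union> J True 1)"
    using bij_betwE[OF bij[of l]] unfolding J_def S_eq by auto
  have FJ: "bij_betw F (J False 1) (coset False 1)" "bij_betw F (J True 0) (coset True 0)"
    "bij_betw F (J True 1) (coset True 1)"
    by (rule bij_betw_cong[OF Fa, THEN iffD2, OF _ fa(1)] bij_betw_cong[OF Fb, THEN iffD2, OF _ fb(1)]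
        bij_betw_cong[OF Fc, THEN iffD2, OF _ fc(1)]; assumption)+
  have FS: "bij_betw F I S"
    unfolding S_eq I using coset_disjoint
    by (intro bij_betw_combine FJ) (auto simp: Int_Un_distrib)
  have finI: "finite I" using bij_betw_finite[OF FS] finite_S by blast
  then have finJ: "finite (J t p)" for t p by (simp add: J_def)
  define M' where "M' i j = (if j = l then F i else M i j)" for i j
  have tot: "total M' (Suc l) i = add (total M l i) (F i)" for i
  proof -
    have "map (M' i) [0..<l] = map (M i) [0..<l]" by (simp add: M'_def)
    then have "total M' l i = total M l i" by (simp only: total_def)
    then show ?thesis by (simp add: total_Suc M'_def)
  qed
  have "image_mset (\<lambda>i. dih_ord m (2 * K) (total M' (Suc l) i)) (mset_set I)
      = image_mset (\<lambda>i. dih_ord m (2 * K) (add (total M l i) (F i))) (mset_set (J False 1))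
      + (image_mset (\<lambda>i. dih_ord m (2 * K) (add (total M l i) (F i))) (mset_set (J True 0))
      + image_mset (\<lambda>i. dih_ord m (2 * K) (add (total M l i) (F i))) (mset_set (J True 1)))"
  proof -
    have "mset_set I = mset_set (J False 1) + (mset_set (J True 0) + mset_set (J True 1))"
      unfolding I using finJ disj by (subst mset_set_Union; simp add: Int_Un_distrib)+
    then show ?thesis by (simp add: tot)
  qed
  also have "\<dots> = (replicate_mset a (nat m) + replicate_mset (?n - a) (nat K))
    + ((replicate_mset b (nat m) + replicate_mset (?n - b) (nat K))
    + (replicate_mset c (nat m) + replicate_mset (?n - c) (nat K)))"
    unfolding fa(2)[symmetric] fb(2)[symmetric] fc(2)[symmetric]
    using finJ by (intro arg_cong2[where f = "(+)"] image_mset_cong) (simp_all add: Fa Fb Fc)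
  also have "\<dots> = replicate_mset (a + b + c) (nat m)
      + replicate_mset ((?n - a) + (?n - b) + (?n - c)) (nat K)"
    by (rule multiset_eqI) simp
  also have "(?n - a) + (?n - b) + (?n - c) = \<beta>"
    using abc(1-4) ab(1) by linarith
  finally have "image_mset (\<lambda>i. dih_ord m (2 * K) (total M' (Suc l) i)) (mset_set I)
      = replicate_mset \<alpha> (nat m) + replicate_mset \<beta> (nat K)"
    by (simp only: abc(1))
  moreover have "bij_betw (\<lambda>i. M' i j) I S" if "j \<le> l" for j
    using that FS bij[of j] by (cases "j = l") (simp_all add: M'_def)
  ultimately show ?thesis by blast
qed

section \<open>Padding by pairs of inverse columns\<close>

definition dih_inv :: "delt \<Rightarrow> delt" where
  "dih_inv x = (case x of (a, b, t) \<Rightarrow> if t then x else el False (- a) (- b))"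

lemma add_inv: "add x (dih_inv x) = dih_zero"
  by (cases x) (simp add: dih_add_def dih_inv_def dih_zero_def mod_simps)

lemma bij_dih_inv: "bij_betw dih_inv S S"
proof (rule bij_betw_byWitness[where f' = dih_inv])
  show "\<forall>x\<in>S. dih_inv (dih_inv x) = x" "\<forall>x\<in>S. dih_inv (dih_inv x) = x"
    by (auto simp: dih_inv_def dih_carrier_def mod_simps)
  have "dih_inv x \<in> S" if "x \<in> S" for x
  proof -
    obtain a b t where x: "x = (a, b, t)" by (metis prod.exhaust)
    have "even (- b mod (2 * K)) \<longleftrightarrow> even b" by (simp add: dvd_mod_iff)
    with that show ?thesis
      using m_pos K_pos unfolding x by (cases t) (simp_all add: dih_inv_def dih_carrier_def dih_two_def)
  qed
  then show "dih_inv ` S \<subseteq> S" "dih_inv ` S \<subseteq> S" by blast+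
qed

lemma foldl_inverse_pairs:
  assumes "x \<in> dih_carrier m (2 * K)"
  shows "foldl add dih_zero (map (\<lambda>j. if even j then x else dih_inv x) [0..<2 * r]) = dih_zero"
proof (induction r)
  case (Suc r)
  have "add dih_zero x = x"
    using assms by (auto simp: dih_add_def dih_zero_def dih_carrier_def)
  with Suc show ?case by (simp add: add_inv)
qed simp

text \<open>Each added pair of columns lists \<open>S\<close> and the inverses in the same row
  order. The pairs stand in front, so every row enters the given array with partial sum
  zero.\<close>

lemma RSM_of_array:
  assumes bij: "\<And>j. j < l \<Longrightarrow> bij_betw (\<lambda>i. M i j) I S" and l: "0 < l"
    and L: "image_mset (\<lambda>i. dih_ord m (2 * K) (total M l i)) (mset_set I) = L"
  shows "\<exists>M'. is_RSM m (2 * K) S (2 * r + l) L M'"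
proof -
  have card: "card I = card S" using bij_betw_same_card[OF bij[OF l]] .
  have finI: "finite I" using bij_betw_finite[OF bij[OF l]] finite_S by blast
  obtain \<phi> where \<phi>: "bij_betw \<phi> {..<card S} I"
    using ex_bij_betw_nat_finite[OF finI] card by (auto simp: lessThan_atLeast0)
  obtain e where e: "bij_betw e {..<card S} S"
    using ex_bij_betw_nat_finite[OF finite_S] by (auto simp: lessThan_atLeast0)
  define M' where "M' i j = (if j < 2 * r then if even j then e i else dih_inv (e i)
    else M (\<phi> i) (j - 2 * r))" for i j
  have col: "bij_betw (\<lambda>i. M' i j) {..<card S} S" if "j < 2 * r + l" for j
  proof (cases "j < 2 * r")
    case True
    then show ?thesis
      using e bij_betw_trans[OF e bij_dih_inv] by (cases "even j") (simp_all add: M'_def comp_def)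
  next
    case False
    with that have "bij_betw (\<lambda>i. M i (j - 2 * r)) I S" by (intro bij) simp
    from bij_betw_trans[OF \<phi> this] False show ?thesis by (simp add: M'_def comp_def)
  qed
  have row: "row_sum m (2 * K) M' (2 * r + l) i = total M l (\<phi> i)" if "i < card S" for i
  proof -
    have "e i \<in> dih_carrier m (2 * K)" using bij_betwE[OF e] that by auto
    then have zero: "foldl add dih_zero (map (M' i) [0..<2 * r]) = dih_zero"
      by (subst foldl_inverse_pairs[of "e i" r, symmetric])
        (auto intro!: arg_cong[where f = "foldl add dih_zero"] simp: M'_def)
    have "[0..<2 * r + l] = [0..<2 * r] @ map (\<lambda>j. j + 2 * r) [0..<l]"
      using upt_add_eq_append[of 0 "2 * r" l] map_add_upt[of "2 * r" l] by (simp add: add.commute)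
    then have "map (M' i) [0..<2 * r + l] = map (M' i) [0..<2 * r] @ map (M (\<phi> i)) [0..<l]"
      by (simp add: M'_def comp_def)
    then show ?thesis
      by (simp only: row_sum_def foldl_append zero total_def)
  qed
  have "image_mset (\<lambda>i. dih_ord m (2 * K) (row_sum m (2 * K) M' (2 * r + l) i)) (mset [0..<card S])
      = image_mset (\<lambda>i. dih_ord m (2 * K) (total M l (\<phi> i))) (mset_set {..<card S})"
    unfolding mset_upt atLeast0LessThan using row by (intro image_mset_cong) simp
  also have "\<dots> = image_mset (\<lambda>i. dih_ord m (2 * K) (total M l i)) (image_mset \<phi> (mset_set {..<card S}))"
    by (simp add: multiset.map_comp comp_def)
  also have "image_mset \<phi> (mset_set {..<card S}) = mset_set I"
    using \<phi> by (simp add: image_mset_mset_set bij_betw_def)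
  finally have ms: "image_mset (\<lambda>i. dih_ord m (2 * K) (row_sum m (2 * K) M' (2 * r + l) i))
      (mset [0..<card S]) = L"
    using L by simp
  have "size L = card S"
    using arg_cong[OF ms, of size] by simp
  with ms col finite_S show ?thesis
    unfolding is_RSM_def by (intro exI[of _ M']) auto
qed

section \<open>Arrays with three and four columns\<close>

lemma el_in_coset: "el t a b \<in> coset t (b mod 2)"
  using m_pos K_pos by (simp add: coset_def dih_carrier_def mod_mod_cancel)

lemma el_eq_iff: "el t a b = el t' a' b' \<longleftrightarrow> t = t' \<and> m dvd a - a' \<and> 2 * K dvd b - b'"
  by (auto simp: mod_eq_dvd_iff)

lemma zero_el: "dih_zero = el False 0 0"
  by (simp add: dih_zero_def)

declare el_def [simp del]

lemma coset_unique: "x \<in> coset t p \<Longrightarrow> x \<in> coset t' p' \<Longrightarrow> t = t' \<and> p = p'"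
  by (auto simp: coset_def)

text \<open>The three exceptional rows end in distinct cosets, so each is the only exception in its
  own. The parameter \<open>p\<close> leaves open which reflection row ends in the even
  coset.\<close>

lemma defect_arrayI:
  assumes bij: "\<And>j. j \<le> l \<Longrightarrow> bij_betw (\<lambda>i. M i j) I S"
    and in_I: "i1 \<in> I" "i2 \<in> I" "i3 \<in> I"
    and last: "M i1 l \<in> coset False 1" "M i2 l \<in> coset True p" "M i3 l \<in> coset True (1 - p)"
    and p: "p = 0 \<or> p = 1"
    and tot: "total M (Suc l) i1 = emb (a1, c1)" "total M (Suc l) i2 = emb (a2, c2)"
      "total M (Suc l) i3 = emb (a3, c3)"
    and adm: "admissible \<alpha> m a1" "admissible \<alpha> m a2" "admissible \<alpha> m a3"
      "admissible \<beta> K c1" "admissible \<beta> K c2" "admissible \<beta> K c3"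
    and zero: "\<And>i. i \<in> I \<Longrightarrow> i \<notin> {i1, i2, i3} \<Longrightarrow> total M (Suc l) i = dih_zero"
  shows "defect_array l \<alpha> \<beta> I M"
proof -
  define P where "P t q \<longleftrightarrow> (\<exists>i0\<in>I. \<exists>s. M i0 l \<in> coset t q
        \<and> total M (Suc l) i0 = emb s \<and> admissible \<alpha> m (fst s) \<and> admissible \<beta> K (snd s)
        \<and> (\<forall>i\<in>I - {i0}. M i l \<in> coset t q \<longrightarrow> total M (Suc l) i = dih_zero))" for t q
  have "P False 1"
    unfolding P_def
  proof (intro bexI[of _ i1] exI[of _ "(a1, c1)"] conjI ballI impI)
    fix i assume "i \<in> I - {i1}" "M i l \<in> coset False 1"
    then show "total M (Suc l) i = dih_zero"
      using coset_unique[OF _ last(2)] coset_unique[OF _ last(3)] by (intro zero) auto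
  qed (use last tot adm in_I in simp_all)
  moreover have "P True p"
    unfolding P_def
  proof (intro bexI[of _ i2] exI[of _ "(a2, c2)"] conjI ballI impI)
    fix i assume "i \<in> I - {i2}" "M i l \<in> coset True p"
    then show "total M (Suc l) i = dih_zero"
      using coset_unique[of "M i1 l" True p, OF _ last(1)]
        coset_unique[of "M i3 l" True p, OF _ last(3)] p by (intro zero) auto
  qed (use last tot adm in_I in simp_all)
  moreover have "P True (1 - p)"
    unfolding P_def
  proof (intro bexI[of _ i3] exI[of _ "(a3, c3)"] conjI ballI impI)
    fix i assume "i \<in> I - {i3}" "M i l \<in> coset True (1 - p)"
    then show "total M (Suc l) i = dih_zero"
      using coset_unique[of "M i1 l" True "1 - p", OF _ last(1)]
        coset_unique[of "M i2 l" True "1 - p", OF _ last(2)] p by (intro zero) auto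
  qed (use last tot adm in_I in simp_all)
  ultimately have "\<forall>(t, q)\<in>{(False, 1), (True, 0), (True, 1)}. P t q"
    using p by auto
  then show ?thesis
    unfolding defect_array_def P_def using bij by blast
qed

section \<open>The zero-sum array with three columns\<close>

text \<open>Three columns: in a row with rotation \<open>x\<close> and reflections \<open>y\<close>, \<open>z\<close>, the total vanishes
  iff \<open>z - y = \<plusminus>x\<close>. Matching \<open>y\<close> with \<open>z = - 1 - y\<close> makes \<open>z - y\<close> run through
  all odd rotations exactly once as \<open>y\<close> runs through an interval of length \<open>K\<close>.\<close>

definition triple :: "nat \<times> int \<times> int \<Rightarrow> nat \<Rightarrow> delt" where
  "triple i j = (case i of (t, a, b) \<Rightarrow>
     if t = 0 then [el False (- 2 * a) (- 1 - 2 * b), el True a b, el True (- a) (- 1 - b)] ! j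
     else if t = 1 then [el True a (b + K), el False (2 * a) (2 * b + 1), el True (- a) (- 1 - b - K)] ! j
     else [el True (- a) (- 1 - b - K), el True a (b + K), el False (2 * a) (2 * b + 1)] ! j)"

lemma total_3: "total M (Suc 2) i = add (add (add dih_zero (M i 0)) (M i (Suc 0))) (M i 2)"
  by (simp add: total_def numeral_2_eq_2)

lemma total_4: "total M (Suc 3) i
    = add (add (add (add dih_zero (M i 0)) (M i (Suc 0))) (M i 2)) (M i 3)"
  by (simp add: total_def numeral_2_eq_2 numeral_3_eq_3)

lemma total_triple: "total triple (Suc 2) i = dih_zero"
proof -
  obtain t a b where i: "i = (t, a, b)" by (metis prod.exhaust)
  show ?thesis
    unfolding total_3 i triple_def zero_el
    by (simp add: add_el el_eq_iff)
qed

text \<open>The reflections are halved by the size of the second coordinate and not by its parity,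
  since each block of reflections in a column of \<open>triple\<close> fills one of these
  intervals.\<close>

definition low :: "delt set" where
  "low = {(a, b, t). t \<and> 0 \<le> a \<and> a < m \<and> 0 \<le> b \<and> b < K}"

definition high :: "delt set" where
  "high = {(a, b, t). t \<and> 0 \<le> a \<and> a < m \<and> K \<le> b \<and> b < 2 * K}"

lemma S_low_high: "S = coset False 1 \<union> (low \<union> high)"
proof (rule set_eqI)
  fix x :: delt
  obtain a b t where x: "x = (a, b, t)" by (metis prod.exhaust)
  show "x \<in> S \<longleftrightarrow> x \<in> coset False 1 \<union> (low \<union> high)"
    unfolding x using K_pos by (cases t)
      (auto simp: coset_def dih_two_def dih_carrier_def low_def high_def odd_iff_mod_2_eq_one)
qed

lemma disjoint_low_high: "coset False 1 \<inter> low = {}" "coset False 1 \<inter> high = {}" "low \<inter> high = {}"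
  by (auto simp: coset_def low_def high_def)

text \<open>The bijection \<open>h\<close> supplies the cardinality of \<open>Y\<close>; injectivity
  into \<open>Y\<close> then suffices, and no inverse of doubling or reflection has to be written
  down.\<close>

lemma bij_W_transfer:
  assumes "inj_on f W" "f ` W \<subseteq> Y" "bij_betw h W Y"
  shows "bij_betw f W Y"
proof -
  have "card (f ` W) = card Y"
    using assms bij_betw_same_card[OF assms(3)] by (simp add: card_image)
  then have "f ` W = Y"
    using assms(2) bij_betw_finite[OF assms(3)] by (simp add: card_subset_eq)
  with assms(1) show ?thesis by (simp add: bij_betw_def)
qed

lemma small_dvd_eq: "x = y" if "q dvd x - y" "0 \<le> x" "x < q" "0 \<le> y" "y < q" for x y q :: int
  using that by (metis mod_eq_dvd_iff mod_pos_pos_trivial)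

lemma inj_minus: "a = a'" if "m dvd - a - - a'" "0 \<le> a" "a < m" "0 \<le> a'" "a' < m"
proof (rule small_dvd_eq)
  have "m dvd - (a - a')" using that(1) by simp
  then show "m dvd a - a'" by (simp only: dvd_minus_iff)
qed (use that in auto)

text \<open>Oddness of \<open>m\<close> makes 2 a unit modulo \<open>m\<close>.\<close>

lemma inj_double: "a = a'" if "m dvd 2 * (a - a')" "0 \<le> a" "a < m" "0 \<le> a'" "a' < m"
proof (rule small_dvd_eq)
  have "coprime m 2" using odd_m by simp
  then show "m dvd a - a'" using that(1) coprime_dvd_mult_right_iff by blast
qed (use that in auto)

lemma bij_low: "bij_betw (\<lambda>w. el True (fst w) (snd w)) W low"
  by (rule bij_betw_byWitness[where f' = "\<lambda>x. (fst x, fst (snd x))"])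
    (auto simp: W_def low_def el_def)

lemma bij_high: "bij_betw (\<lambda>w. el True (fst w) (snd w + K)) W high"
  by (rule bij_betw_byWitness[where f' = "\<lambda>x. (fst x, fst (snd x) - K)"])
    (auto simp: W_def high_def el_def)

lemma mod_eqI: "x mod q = r" if "0 \<le> r" "r < q" "q dvd x - r" for x q r :: int
  using that by (metis mod_eq_dvd_iff mod_pos_pos_trivial)

lemma reflect_mod: "(- 1 - b) mod (2 * K) = 2 * K - 1 - b" "(- 1 - b - K) mod (2 * K) = K - 1 - b"
  if "0 \<le> b" "b < K" for b
  using that by (auto intro!: mod_eqI)

lemma bij_high_reflect: "bij_betw (\<lambda>w. el True (- fst w) (- 1 - snd w)) W high"
proof (rule bij_W_transfer[OF _ _ bij_high])
  show "inj_on (\<lambda>w. el True (- fst w) (- 1 - snd w)) W"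
    by (rule inj_onI)
      (auto simp: W_def el_def reflect_mod mod_eq_dvd_iff[of "- _"] intro: inj_minus)
  show "(\<lambda>w. el True (- fst w) (- 1 - snd w)) ` W \<subseteq> high"
    using m_pos by (auto simp: W_def high_def el_def reflect_mod)
qed

lemma bij_low_reflect: "bij_betw (\<lambda>w. el True (- fst w) (- 1 - snd w - K)) W low"
proof (rule bij_W_transfer[OF _ _ bij_low])
  show "inj_on (\<lambda>w. el True (- fst w) (- 1 - snd w - K)) W"
    by (rule inj_onI)
      (auto simp: W_def el_def reflect_mod mod_eq_dvd_iff[of "- _"] intro: inj_minus)
  show "(\<lambda>w. el True (- fst w) (- 1 - snd w - K)) ` W \<subseteq> low"
    using m_pos by (auto simp: W_def low_def el_def reflect_mod)
qed

lemma W_eq_doubleI: "w = w'" if "w \<in> W" "w' \<in> W" "m dvd 2 * (fst w - fst w')"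
  "2 * K dvd 2 * (snd w - snd w')"
proof (rule prod_eqI)
  show "fst w = fst w'" using that by (intro inj_double) (auto simp: W_def)
  have "K dvd snd w - snd w'" using that(4) by (simp only: dvd_mult_cancel_left) simp
  then show "snd w = snd w'" using that by (intro small_dvd_eq) (auto simp: W_def)
qed

lemma bij_rotations: "bij_betw (\<lambda>w. el False (2 * fst w) (2 * snd w + 1)) W (coset False 1)"
proof (rule bij_W_transfer[OF _ _ bij_coset])
  show "inj_on (\<lambda>w. el False (2 * fst w) (2 * snd w + 1)) W"
    by (rule inj_onI, rule W_eq_doubleI) (auto simp: el_eq_iff right_diff_distrib)
  have "el False (2 * a) (2 * b + 1) \<in> coset False 1" for a b
    using el_in_coset[of False "2 * a" "2 * b + 1"] by simp
  then show "(\<lambda>w. el False (2 * fst w) (2 * snd w + 1)) ` W \<subseteq> coset False 1" by blast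
qed simp

lemma bij_rotations_reflect: "bij_betw (\<lambda>w. el False (- 2 * fst w) (- 1 - 2 * snd w)) W (coset False 1)"
proof (rule bij_W_transfer[OF _ _ bij_coset])
  show "inj_on (\<lambda>w. el False (- 2 * fst w) (- 1 - 2 * snd w)) W"
    by (rule inj_onI, rule W_eq_doubleI[THEN sym]) (auto simp: el_eq_iff right_diff_distrib)
  have "(- 1 - 2 * b) mod 2 = 1" for b :: int by presburger
  then have "el False (- 2 * a) (- 1 - 2 * b) \<in> coset False 1" for a b
    using el_in_coset[of False "- 2 * a" "- 1 - 2 * b"] by simp
  then show "(\<lambda>w. el False (- 2 * fst w) (- 1 - 2 * snd w)) ` W \<subseteq> coset False 1" by blast
qed simp

lemma bij_three_parts:
  assumes f: "bij_betw f W X" "bij_betw g W Y" "bij_betw h W Z"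
    and disj: "X \<inter> Y = {}" "X \<inter> Z = {}" "Y \<inter> Z = {}"
  shows "bij_betw (\<lambda>i. if fst i = 0 then f (snd i) else if fst i = 1 then g (snd i) else h (snd i))
    ({0, 1, 2 :: nat} \<times> W) (X \<union> (Y \<union> Z))" (is "bij_betw ?F _ _")
proof -
  have snd: "bij_betw snd ({t :: nat} \<times> W) W" for t
    by (auto simp: bij_betw_def inj_on_def)
  have "bij_betw ?F ({0} \<times> W) X"
    by (rule bij_betw_cong[THEN iffD2, OF _ bij_betw_trans[OF snd f(1)]]) auto
  moreover have "bij_betw ?F ({1} \<times> W) Y"
    by (rule bij_betw_cong[THEN iffD2, OF _ bij_betw_trans[OF snd f(2)]]) auto
  moreover have "bij_betw ?F ({2} \<times> W) Z"
    by (rule bij_betw_cong[THEN iffD2, OF _ bij_betw_trans[OF snd f(3)]]) auto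
  ultimately have "bij_betw ?F ({0} \<times> W \<union> ({1} \<times> W \<union> {2} \<times> W)) (X \<union> (Y \<union> Z))"
    using disj by (intro bij_betw_combine) auto
  moreover have "{0, 1, 2 :: nat} \<times> W = {0} \<times> W \<union> ({1} \<times> W \<union> {2} \<times> W)" by auto
  ultimately show ?thesis by simp
qed

lemma bij_triple:
  assumes "j \<le> 2"
  shows "bij_betw (\<lambda>i. triple i j) ({0, 1, 2} \<times> W) S"
proof -
  have "j = 0 \<or> j = 1 \<or> j = 2" using assms by auto
  moreover have "bij_betw (\<lambda>i. triple i 0) ({0, 1, 2} \<times> W) (coset False 1 \<union> (high \<union> low))"
    by (rule bij_betw_cong[THEN iffD2, OF _ bij_three_parts[OF bij_rotations_reflect bij_high bij_low_reflect]])
      (use disjoint_low_high in \<open>auto simp: triple_def\<close>)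
  moreover have "bij_betw (\<lambda>i. triple i 1) ({0, 1, 2} \<times> W) (low \<union> (coset False 1 \<union> high))"
    by (rule bij_betw_cong[THEN iffD2, OF _ bij_three_parts[OF bij_low bij_rotations bij_high]])
      (use disjoint_low_high in \<open>auto simp: triple_def\<close>)
  moreover have "bij_betw (\<lambda>i. triple i 2) ({0, 1, 2} \<times> W) (high \<union> (low \<union> coset False 1))"
    by (rule bij_betw_cong[THEN iffD2, OF _ bij_three_parts[OF bij_high_reflect bij_low_reflect bij_rotations]])
      (use disjoint_low_high in \<open>auto simp: triple_def\<close>)
  ultimately show ?thesis
    unfolding S_low_high by (auto simp: Un_ac)
qed

section \<open>Exceptional rows in the array with three columns\<close>

lemma admissible_even: "even n \<Longrightarrow> admissible n q 0"
  by (simp add: admissible_def)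

lemma admissible_unit: "odd n \<Longrightarrow> admissible n q 1" "odd n \<Longrightarrow> admissible n q (- 1)"
  by (simp_all add: admissible_def)

text \<open>The exceptional totals have first components \<open>J\<close> and \<open>2 * J\<close>
  or \<open>- 2 * J\<close>. For odd \<open>n\<close>, \<open>J = 1\<close> serves since
  \<open>m\<close> is odd; if \<open>m = 1\<close>, the bound forces \<open>J = 0\<close>, which is
  a unit modulo 1.\<close>

lemma ex_admissible:
  obtains J where "0 \<le> J" "J < m" "admissible n m J" "admissible n m (2 * J)" "admissible n m (- 2 * J)"
proof (cases "odd n \<and> m > 1")
  case True
  then show thesis
    using odd_m by (intro that[of 1]) (simp_all add: admissible_def)
next
  case False
  then have "odd n \<Longrightarrow> m = 1" using m_pos by auto
  then show thesis
    using m_pos by (intro that[of 0]) (simp_all add: admissible_def)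
qed

text \<open>The three expressions that are compared with \<open>2 c\<^sub>1\<close>, \<open>2 c\<^sub>2\<close>, \<open>2 c\<^sub>3\<close> are the row sums of the rows
  \<open>(0, 0, p)\<close>, \<open>(1, J, r)\<close>, \<open>(2, 0, r)\<close> of the zero-sum array after every column has exchanged its two
  reflections among them.\<close>

lemma defect_array_swap:
  assumes J: "0 \<le> J" "J < m" "admissible \<alpha> m J" "admissible \<alpha> m (- 2 * J)"
    and pr: "0 \<le> p" "p < K" "0 \<le> r" "r < K" "odd (r + K - p)"
    and c: "2 * K dvd 2 * r - 2 * p + 2 * K - 2 * c1" "2 * K dvd p - 3 * r - K - 1 - 2 * c2"
      "2 * K dvd 3 * r + K + 1 - p - 2 * c3"
    and adm: "admissible \<beta> K c1" "admissible \<beta> K c2" "admissible \<beta> K c3"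
  shows "\<exists>(I :: (nat \<times> int \<times> int) set) M. defect_array 2 \<alpha> \<beta> I M"
proof -
  define i1 :: "nat \<times> int \<times> int" where "i1 = (0, 0, p)"
  define i2 :: "nat \<times> int \<times> int" where "i2 = (1, J, r)"
  define i3 :: "nat \<times> int \<times> int" where "i3 = (2, 0, r)"
  \<comment> \<open>Columns 0, 1, 2 have the rotation of these three rows in \<open>i1\<close>,
    \<open>i2\<close>, \<open>i3\<close>, respectively; it is left in place.\<close>
  define \<sigma> where "\<sigma> j = (if j = 0 then transpose i2 i3 else if j = 1 then transpose i1 i3
    else transpose i1 i2)" for j :: nat
  define M where "M i j = triple (\<sigma> j i) j" for i j
  let ?I = "{0, 1, 2 :: nat} \<times> W"
  have I: "i1 \<in> ?I" "i2 \<in> ?I" "i3 \<in> ?I"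
    using J pr m_pos by (auto simp: i1_def i2_def i3_def W_def)
  have \<sigma>: "bij_betw (\<sigma> j) ?I ?I" for j
    using I by (simp add: \<sigma>_def bij_betw_transpose_iff)
  have d: "i1 \<noteq> i2" "i1 \<noteq> i3" "i2 \<noteq> i3" by (simp_all add: i1_def i2_def i3_def)
  have M1: "M i1 0 = triple i1 0" "M i1 1 = triple i3 1" "M i1 2 = triple i2 2"
    and M2: "M i2 0 = triple i3 0" "M i2 1 = triple i2 1" "M i2 2 = triple i1 2"
    and M3: "M i3 0 = triple i2 0" "M i3 1 = triple i1 1" "M i3 2 = triple i3 2"
    using d by (simp_all add: M_def \<sigma>_def)
  have "defect_array 2 \<alpha> \<beta> ?I M"
  \<comment> \<open>Row \<open>i3\<close> still ends in a rotation, while \<open>i1\<close> and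
    \<open>i2\<close> end in reflections with second coordinates \<open>- 1 - r - K\<close> and
    \<open>- 1 - p\<close>; their parities differ because \<open>r + K - p\<close> is odd.\<close>
  proof (rule defect_arrayI[of _ _ _ i3 i1 i2])
    show "bij_betw (\<lambda>i. M i j) ?I S" if "j \<le> 2" for j
      using bij_betw_trans[OF \<sigma> bij_triple[OF that]] by (simp add: M_def comp_def)
    show "M i3 2 \<in> coset False 1"
      unfolding M3 unfolding i3_def triple_def using el_in_coset[of False 0 "2 * r + 1"] by simp
    show "M i1 2 \<in> coset True ((- 1 - r - K) mod 2)"
      unfolding M1 unfolding i2_def triple_def using el_in_coset[of True "- J" "- 1 - r - K"] by simp
    have "1 - (- 1 - r - K) mod 2 = (- 1 - p) mod 2"
      using pr(5) by presburger
    then show "M i2 2 \<in> coset True (1 - (- 1 - r - K) mod 2)"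
      unfolding M2 unfolding i1_def triple_def using el_in_coset[of True 0 "- 1 - p"] by simp
    show "(- 1 - r - K) mod 2 = 0 \<or> (- 1 - r - K) mod 2 = 1"
      by presburger
    show "total M (Suc 2) i3 = emb (J, c3)"
      unfolding total_3 One_nat_def[symmetric] unfolding M3
      unfolding i1_def i2_def i3_def triple_def zero_el emb_def
      using c(3) by (simp add: add_el el_eq_iff; simp add: algebra_simps)
    show "total M (Suc 2) i1 = emb (J, c1)"
      unfolding total_3 One_nat_def[symmetric] unfolding M1
      unfolding i1_def i2_def i3_def triple_def zero_el emb_def
      using c(1) by (simp add: add_el el_eq_iff; simp add: algebra_simps)
    show "total M (Suc 2) i2 = emb (- 2 * J, c2)"
      unfolding total_3 One_nat_def[symmetric] unfolding M2
      unfolding i1_def i2_def i3_def triple_def zero_el emb_def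
      using c(2) by (simp add: add_el el_eq_iff; simp add: algebra_simps)
    show "total M (Suc 2) i = dih_zero" if "i \<notin> {i3, i1, i2}" for i
    proof -
      have "\<sigma> j i = i" for j using that by (simp add: \<sigma>_def)
      then have "total M (Suc 2) i = total triple (Suc 2) i" unfolding total_3 by (simp add: M_def)
      then show ?thesis by (simp only: total_triple)
    qed
  qed (use J adm I in simp_all)
  then show ?thesis by blast
qed

lemma ex_defect_array_3:
  assumes ab: "\<alpha> + \<beta> = 3 * nat (m * K)"
  shows "\<exists>(I :: (nat \<times> int \<times> int) set) M. defect_array 2 \<alpha> \<beta> I M"
proof -
  obtain J where J: "0 \<le> J" "J < m" "admissible \<alpha> m J" "admissible \<alpha> m (- 2 * J)"
    using ex_admissible by metis
  consider "odd \<beta>" | "even \<beta>" "odd \<alpha>" | "even \<beta>" "even \<alpha>" by blast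
  then show ?thesis
  proof cases
    case 1
    \<comment> \<open>For \<open>p = 0\<close> and \<open>r = K - 1\<close> the three expressions
      are -2, 2, -2 modulo \<open>2 * K\<close>, so the second components -1, 1, -1 are
      units.\<close>
    show ?thesis
      by (rule defect_array_swap[OF J, of 0 "K - 1" "- 1" 1 "- 1"])
        (use K_pos 1 in \<open>simp_all add: admissible_unit algebra_simps\<close>)
  next
    case 2
    \<comment> \<open>Here \<alpha> + \<beta> is odd, hence so is \<open>K\<close>. With
      \<open>p = r = (K - 1) div 2\<close> all three expressions are multiples of
      \<open>2 * K\<close>, and the second components vanish.\<close>
    have "odd (nat (m * K))" using 2 arg_cong[OF ab, of even] by auto
    then have "odd (m * K)" using m_pos K_pos by (simp add: even_nat_iff)
    then obtain r where r: "K = 2 * r + 1" by (auto elim: oddE)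
    show ?thesis
    proof (rule defect_array_swap[OF J, of r r 0 0 0])
      have "r - 3 * r - K - 1 - 2 * 0 = 2 * K * (- 1)" "3 * r + K + 1 - r - 2 * 0 = 2 * K * 1"
        using r by simp_all
      then show "2 * K dvd r - 3 * r - K - 1 - 2 * 0" "2 * K dvd 3 * r + K + 1 - r - 2 * 0"
        by (metis dvd_triv_left)+
    qed (use K_pos 2 r in \<open>simp_all add: admissible_even\<close>)
  next
    case 3
    \<comment> \<open>No defect is wanted, so any row ending in each coset can be named. Row
      \<open>(1, 0, K - 1)\<close> ends in second coordinate \<open>- 2 * K\<close>, even for every
      \<open>K\<close>.\<close>
    have "defect_array 2 \<alpha> \<beta> ({0, 1, 2 :: nat} \<times> W) triple"
    proof (rule defect_arrayI[of _ _ _ "(2, 0, K - 1)" "(1, 0, K - 1)" "(0, 0, 0)"])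
      show "triple (2, 0, K - 1) 2 \<in> coset False 1"
        using el_in_coset[of False 0 "2 * (K - 1) + 1"] by (simp add: triple_def mod_2_eq_odd)
      show "triple (1, 0, K - 1) 2 \<in> coset True 0"
        using el_in_coset[of True 0 "- 1 - (K - 1) - K"] by (simp add: triple_def)
      show "triple (0, 0, 0) 2 \<in> coset True (1 - 0)"
        using el_in_coset[of True 0 "- 1"] by (simp add: triple_def)
      show "total triple (Suc 2) (2, 0, K - 1) = emb (0, 0)" "total triple (Suc 2) (1, 0, K - 1) = emb (0, 0)"
        "total triple (Suc 2) (0, 0, 0) = emb (0, 0)"
        by (simp_all only: total_triple zero_eq_emb)
    qed (use 3 m_pos K_pos bij_triple total_triple in \<open>simp_all add: W_def admissible_even\<close>)
    then show ?thesis by blast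
  qed
qed

section \<open>The zero-sum array with four columns and its exceptional rows\<close>

text \<open>Four columns: rows \<open>x, - x, y, - y\<close> have total zero; a three-cycle on the second and fourth
  entries of rows starting in the three different cosets creates the exceptional totals.\<close>

definition turn :: "int \<Rightarrow> int \<Rightarrow> delt \<Rightarrow> delt" where
  "turn J d x = (case x of (a, b, t) \<Rightarrow> if t then x else el False (a - J) (b - 2 * d))"

text \<open>Using \<open>turn J d x\<close> for the second pair keeps the row total zero, but a
  rotation \<open>x\<close> then exceeds its turned copy by \<open>emb (J, d)\<close>. This
  difference appears once inverses move to other rows.\<close>

definition quad :: "int \<Rightarrow> int \<Rightarrow> delt \<Rightarrow> nat \<Rightarrow> delt" where
  "quad J d x j = [x, dih_inv x, turn J d x, dih_inv (turn J d x)] ! j"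

lemma dih_inv_el: "dih_inv (el t a b) = (if t then el t a b else el t (- a) (- b))"
  by (simp add: dih_inv_def el_def mod_simps)

lemma turn_el: "turn J d (el t a b) = (if t then el t a b else el t (a - J) (b - 2 * d))"
  by (simp add: turn_def el_def mod_simps)

lemma S_elE:
  assumes "x \<in> S"
  obtains t a b where "x = el t a b" "t \<or> odd b"
proof -
  obtain a b t where x: "x = (a, b, t)" by (metis prod.exhaust)
  show thesis
    by (rule that[of t a b]) (use assms in \<open>auto simp: x el_def dih_carrier_def dih_two_def\<close>)
qed

lemma el_in_S: "t \<or> odd b \<Longrightarrow> el t a b \<in> S"
  using el_in_coset[of t a b] unfolding S_eq by (cases t; cases "even b") (auto simp: odd_iff_mod_2_eq_one)

lemma bij_turn: "bij_betw (turn J d) S S"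
proof (rule bij_betw_byWitness[where f' = "turn (- J) (- d)"])
  show "\<forall>x\<in>S. turn (- J) (- d) (turn J d x) = x" "\<forall>x\<in>S. turn J d (turn (- J) (- d) x) = x"
    by (auto elim!: S_elE simp: turn_el)
  have "turn J d x \<in> S" if x: "x \<in> S" for x J d
  proof -
    obtain t a b where tab: "x = el t a b" "t \<or> odd b" using S_elE[OF x] by blast
    then have "turn J d x = el t (if t then a else a - J) (if t then b else b - 2 * d)"
      by (simp add: turn_el)
    moreover have "t \<or> odd (if t then b else b - 2 * d)" using tab(2) by auto
    ultimately show ?thesis using el_in_S by metis
  qed
  then show "turn J d ` S \<subseteq> S" "turn (- J) (- d) ` S \<subseteq> S" by blast+
qed

lemma bij_quad:
  assumes "j \<le> 3"
  shows "bij_betw (\<lambda>x. quad J d x j) S S"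
proof -
  have "j = 0 \<or> j = 1 \<or> j = 2 \<or> j = 3" using assms by auto
  moreover have "bij_betw (\<lambda>x. x) S S" by (auto simp: bij_betw_def)
  moreover have "bij_betw (\<lambda>x. dih_inv (turn J d x)) S S"
    using bij_betw_trans[OF bij_turn bij_dih_inv] by (simp add: comp_def)
  ultimately show ?thesis
    using bij_dih_inv bij_turn by (auto simp: quad_def)
qed

lemma total_quad: "x \<in> S \<Longrightarrow> total (quad J d) (Suc 3) x = dih_zero"
  unfolding total_4 by (erule S_elE) (auto simp: quad_def zero_el add_el dih_inv_el turn_el)

text \<open>Row \<open>x2\<close> becomes the double of the rotation \<open>x2 + x3\<close>, with
  coordinates \<open>(2 * J, - 2 * q)\<close>; rows \<open>x1\<close> and \<open>x3\<close> both
  retain the difference \<open>(J, 2 * d)\<close> of \<open>x1\<close> and its turned copy.\<close>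

lemma defect_array_cycle:
  assumes J: "admissible \<alpha> m J" "admissible \<alpha> m (2 * J)" and q: "odd q"
    and c: "2 * K dvd - (2 * q) - 2 * c" and adm: "admissible \<beta> K d" "admissible \<beta> K c"
  shows "\<exists>(I :: delt set) M. defect_array 3 \<alpha> \<beta> I M"
proof -
  define x1 where "x1 = el False 0 1"
  define x2 where "x2 = el True 0 0"
  define x3 where "x3 = el True (- J) q"
  have co: "x1 \<in> coset False 1" "x2 \<in> coset True 0" "x3 \<in> coset True 1"
    using el_in_coset[of False 0 1] el_in_coset[of True 0 0] el_in_coset[of True "- J" q] q
    by (simp_all add: x1_def x2_def x3_def odd_iff_mod_2_eq_one)
  have d: "x1 \<noteq> x2" "x1 \<noteq> x3" "x2 \<noteq> x3"
    using co coset_unique by fastforce+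
  have xS: "x1 \<in> S" "x2 \<in> S" "x3 \<in> S" using co unfolding S_eq by auto
  define \<tau> where "\<tau> = transpose x1 x2 \<circ> transpose x2 x3"
  have \<tau>: "\<tau> x1 = x2" "\<tau> x2 = x3" "\<tau> x3 = x1" "\<And>x. x \<notin> {x1, x2, x3} \<Longrightarrow> \<tau> x = x"
    using d by (auto simp: \<tau>_def)
  have bij_\<tau>: "bij_betw \<tau> S S"
    unfolding \<tau>_def using xS by (intro bij_betw_trans[of _ S S]) (simp_all add: bij_betw_transpose_iff)
  define M where "M x j = quad J d (if odd j then \<tau> x else x) j" for x j
  have "defect_array 3 \<alpha> \<beta> S M"
  proof (rule defect_arrayI[of _ _ _ x3 x1 x2])
    show "bij_betw (\<lambda>i. M i j) S S" if "j \<le> 3" for j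
      using bij_quad[OF that, of J d] bij_betw_trans[OF bij_\<tau> bij_quad[OF that, of J d]]
      by (cases "odd j") (simp_all add: M_def comp_def)
    have "(2 * d - 1) mod 2 = 1" by presburger
    then show "M x3 3 \<in> coset False 1"
      using el_in_coset[of False J "2 * d - 1"] by (simp add: M_def \<tau> quad_def x1_def turn_el dih_inv_el)
    show "M x1 3 \<in> coset True 0"
      using co by (simp add: M_def \<tau> quad_def x2_def turn_el dih_inv_el)
    show "M x2 3 \<in> coset True (1 - 0)"
      using co by (simp add: M_def \<tau> quad_def x3_def turn_el dih_inv_el)
    show "total M (Suc 3) x1 = emb (J, d)" "total M (Suc 3) x3 = emb (J, d)"
      unfolding total_4 by (simp_all add: M_def \<tau> quad_def)
        (simp_all add: x1_def x2_def x3_def zero_el emb_def turn_el dih_inv_el add_el)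
    show "total M (Suc 3) x2 = emb (2 * J, c)"
      unfolding total_4 using c by (simp add: M_def \<tau> quad_def)
        (simp add: x2_def x3_def zero_el emb_def turn_el dih_inv_el add_el el_eq_iff; simp add: algebra_simps)
    show "total M (Suc 3) x = dih_zero" if "x \<in> S" "x \<notin> {x3, x1, x2}" for x
    proof -
      have "\<tau> x = x" using that \<tau>(4) by blast
      then have "total M (Suc 3) x = total (quad J d) (Suc 3) x" unfolding total_4 by (simp add: M_def)
      then show ?thesis using total_quad[OF that(1)] by simp
    qed
  qed (use J adm xS in simp_all)
  then show ?thesis by blast
qed

lemma ex_defect_array_4:
  assumes ab: "\<alpha> + \<beta> = 3 * nat (m * K)"
  shows "\<exists>(I :: delt set) M. defect_array 3 \<alpha> \<beta> I M"
proof -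
  obtain J where J: "admissible \<alpha> m J" "admissible \<alpha> m (2 * J)"
    using ex_admissible by metis
  consider "odd \<beta>" | "even \<beta>" "odd \<alpha>" | "even \<beta>" "even \<alpha>" by blast
  then show ?thesis
  proof cases
    case 1
    \<comment> \<open>The choice \<open>q = - 1\<close> gives \<open>c = 1\<close>, and
      \<open>d = 1\<close>; both are units modulo \<open>K\<close>.\<close>
    show ?thesis
      by (rule defect_array_cycle[OF J, of "- 1" 1 _ 1]) (use 1 in \<open>simp_all add: admissible_unit\<close>)
  next
    case 2
    \<comment> \<open>As \<alpha> + \<beta> is odd, so is \<open>K\<close>. Hence
      \<open>q = K\<close> may be chosen, and \<open>2 * q\<close> vanishes modulo
      \<open>2 * K\<close>.\<close>
    have "odd (nat (m * K))" using 2 arg_cong[OF ab, of even] by auto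
    then have "odd K" using m_pos K_pos by (simp add: even_nat_iff)
    then show ?thesis
      by (intro defect_array_cycle[OF J, of K 0 _ 0]) (use 2 in \<open>simp_all add: admissible_even\<close>)
  next
    case 3
    have "defect_array 3 \<alpha> \<beta> S (quad 0 0)"
    proof (rule defect_arrayI[of _ _ _ "el False 0 1" "el True 0 0" "el True 0 1"])
      show "el False 0 1 \<in> S" "el True 0 0 \<in> S" "el True 0 1 \<in> S"
        by (rule el_in_S, simp)+
      show "quad 0 0 (el False 0 1) 3 \<in> coset False 1"
        using el_in_coset[of False 0 "- 1"] by (simp add: quad_def dih_inv_el turn_el)
      show "quad 0 0 (el True 0 0) 3 \<in> coset True 0" "quad 0 0 (el True 0 1) 3 \<in> coset True (1 - 0)"
        using el_in_coset[of True 0 0] el_in_coset[of True 0 1] by (simp_all add: quad_def dih_inv_el turn_el)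
      show "total (quad 0 0) (Suc 3) (el False 0 1) = emb (0, 0)"
        "total (quad 0 0) (Suc 3) (el True 0 0) = emb (0, 0)"
        "total (quad 0 0) (Suc 3) (el True 0 1) = emb (0, 0)"
        unfolding zero_eq_emb[symmetric] by (rule total_quad, rule el_in_S, simp)+
    qed (use 3 bij_quad total_quad in \<open>simp_all add: admissible_even\<close>)
    then show ?thesis by blast
  qed
qed

lemma RSM_of_defect_array:
  assumes "defect_array l \<alpha> \<beta> I M" "\<alpha> + \<beta> = 3 * nat (m * K)" "\<alpha> \<noteq> 1" "\<beta> \<noteq> 1"
  shows "\<exists>M'. is_RSM m (2 * K) S (2 * r + Suc l) (replicate_mset \<alpha> (nat m) + replicate_mset \<beta> (nat K)) M'"
  using defect_array_adjust[OF assms] RSM_of_array[of "Suc l"] by (metis less_Suc_eq_le zero_less_Suc)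

end

theorem mainTheorem10:
  fixes g k m n \<alpha> \<beta> :: nat
  assumes "g \<ge> 3"
    and "m \<ge> 1" and "odd m" and "n \<ge> 1" and "odd n"
    and "\<alpha> \<noteq> 1" and "\<beta> \<noteq> 1"
    and "\<alpha> + \<beta> = 3 * 2 ^ k * m * n"
  shows "\<exists>M. is_RSM (int m) (int (2 ^ (k + 1) * n))
            (dih_carrier (int m) (int (2 ^ (k + 1) * n)) - dih_two (int m) (int (2 ^ (k + 1) * n)))
            g (replicate_mset \<alpha> m + replicate_mset \<beta> (2 ^ k * n)) M"
proof -
  define K where "K = int (2 ^ k * n)"
  interpret gen_dihedral "int m" K
    using assms by unfold_locales (auto simp: K_def)
  have N: "int (2 ^ (k + 1) * n) = 2 * K" and nK: "nat K = 2 ^ k * n"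
    by (simp_all only: K_def nat_int) simp
  have ab: "\<alpha> + \<beta> = 3 * nat (int m * K)"
    using assms(8) by (simp add: K_def nat_mult_distrib mult_ac)
  \<comment> \<open>\<open>r\<close> counts the pairs of inverse columns; the core array has three
    columns for odd \<open>g\<close> and four for even \<open>g\<close>.\<close>
  define r where "r = (g - 3) div 2"
  have "g = 2 * r + Suc 2 \<or> g = 2 * r + Suc 3"
    unfolding r_def using assms(1) by presburger
  then show ?thesis
  proof
    assume g: "g = 2 * r + Suc 2"
    show ?thesis
      using ex_defect_array_3[OF ab] RSM_of_defect_array[OF _ ab assms(6,7), where r = r]
      unfolding g N nK[symmetric] by (metis nat_int)
  next
    assume g: "g = 2 * r + Suc 3"
    show ?thesis
      using ex_defect_array_4[OF ab] RSM_of_defect_array[OF _ ab assms(6,7), where r = r]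
      unfolding g N nK[symmetric] by (metis nat_int)
  qed
qed

end
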